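(* Let $\mathcal A$ be a full subcategory, closed under extensions, of an $n$-angulated category $\mathcal T$, and let $\mathfrak E$ be an almost $n$-exact structure for $\mathcal A$. Let $\mathbf{Ideals}(\mathcal A)$ be the class of all ideals in $\mathcal A$ and $\mathbf{Ex}(\mathfrak E)$ the class of all almost $n$-exact structures for $\mathcal A$ included in $\mathfrak E$, both ordered by inclusion. Then the pairs of correspondences $$\mathfrak{PB}_{\mathfrak E}:\mathbf{Ideals}(\mathcal A)\rightleftarrows\mathbf{Ex}(\mathfrak E):\Phi_{\mathfrak E},\qquad \mathfrak{PO}_{\mathfrak E}:\mathbf{Ideals}(\mathcal A)\rightleftarrows\mathbf{Ex}(\mathfrak E):\Phi^{\mathfrak E}$$ determine two monotone Galois connections with respect to inclusion; that is, for every $\mathcal I\in\mathbf{Ideals}(\mathcal A)$ and every $\mathfrak F\in\mathbf{Ex}(\mathfrak E)$, $\mathfrak{PB}_{\mathfrak E}(\mathcal I)\subseteq\mathfrak F$ if and only if $\mathcal I\subseteq\Phi_{\mathfrak E}(\mathfrak F)$, and $\mathfrak{PO}_{\mathfrak E}(\mathcal I)\subseteq\mathfrak F$ if and only if $\mathcal I\subseteq\Phi^{\mathfrak E}(\mathfrak F)$.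
   Context: Let $n\geq 3$ be an integer. An $n$-angulated category is an additive category $\mathcal T$ with an automorphism $\Sigma$ and a collection of sequences $A_1\xrightarrow{\alpha_1}A_2\xrightarrow{\alpha_2}\cdots\xrightarrow{\alpha_{n-1}}A_n\xrightarrow{\alpha_n}\Sigma A_1$, called $n$-angles, satisfying the following (a morphism of such sequences is a tuple $(\varphi_1,\dots,\varphi_n)$ commuting with all maps, with $\Sigma\varphi_1$ on the last term). (F1) The collection is closed under direct sums and direct summands, contains $A\xrightarrow{1}A\to0\to\cdots\to0\to\Sigma A$ for all $A$, and every morphism $\alpha_1:A_1\to A_2$ is the first morphism of some $n$-angle. (F2) A sequence is an $n$-angle iff its left rotation $A_2\xrightarrow{\alpha_2}\cdots\xrightarrow{\alpha_n}\Sigma A_1\xrightarrow{(-1)^n\Sigma\alpha_1}\Sigma A_2$ is. (F3) Given two $n$-angles $(A_i,\alpha_i)$, $(B_i,\beta_i)$ and $\varphi_1,\varphi_2$ with $\varphi_2\alpha_1=\beta_1\varphi_1$, there are $\varphi_3,\dots,\varphi_n$ making $(\varphi_1,\dots,\varphi_n)$ a morphism. (F4) In (F3) these can be chosen so that the cone $A_2\oplus B_1\to A_3\oplus B_2\to\cdots\to\Sigma A_1\oplus B_n\to\Sigma A_2\oplus\Sigma B_1$, with maps $\begin{pmatrix}-\alpha_{i+1}&0\\ \varphi_{i+1}&\beta_i\end{pmatrix}$ ($1\le i\le n-1$) and finally $\begin{pmatrix}-\Sigma\alpha_1&0\\ \Sigma\varphi_1&\beta_n\end{pmatrix}$, is an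 $n$-angle. An $n$-angle is split if $\alpha_n=0$. $\mathcal A\subseteq\mathcal T$ is a full subcategory, closed under isomorphisms and closed under extensions: for every $n$-angle with $A_1,A_n\in\mathcal A$ also $A_2,\dots,A_{n-1}\in\mathcal A$. $\mathfrak D_{\mathcal A}$ is the class of all $n$-angles with $A_1,\dots,A_n\in\mathcal A$. A class $\mathfrak E\subseteq\mathfrak D_{\mathcal A}$ is an almost $n$-exact structure for $\mathcal A$ if: (N1) $\mathfrak E$ is closed under direct sums and contains all split $n$-angles (in $\mathfrak D_{\mathcal A}$); (N2) if $\mathfrak d\in\mathfrak E$ has last morphism $\alpha_n:A_n\to\Sigma A_1$ and $f:B_n\to A_n$ is in $\mathcal A$, then every $n$-angle $A_1\to B_2\to\cdots\to B_n\xrightarrow{\alpha_nf}\Sigma A_1$ admitting a morphism of $n$-angles $(1_{A_1},*,\dots,*,f)$ to $\mathfrak d$ is in $\mathfrak E$; (N3) if $\mathfrak d\in\mathfrak E$ is as before and $g:A_1\to C_1$ is in $\mathcal A$, then every $n$-angle $C_1\to C_2\to\cdots\to A_n\xrightarrow{(\Sigma g)\alpha_n}\Sigma C_1$ receiving a morphism of $n$-angles $(g,*,\dots,*,1_{A_n})$ from $\mathfrak d$ is in $\mathfrak E$. For an $n$-angle in $\mathfrak E$, the last morphism $\alpha_n$ is called its $\mathfrak E$-phantom; $\Phi(\mathfrak E)$ is the class of all $\mathfrak E$-phantoms. The same terminology is used for any almost $n$-exact structure for $\mathcal A$. An ideal in $\mathcal A$ is a class of morphisms of $\mathcal A$ forming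 a subfunctor of the (additive) bifunctor $\mathrm{Hom}_{\mathcal A}(-,-)$. For an almost $n$-exact structure $\mathfrak F\subseteq\mathfrak E$: $\Phi_{\mathfrak E}(\mathfrak F)$ is the class of morphisms $\phi$ in $\mathcal A$ with $h\phi\in\Phi(\mathfrak F)$ for all (composable) $h\in\Phi(\mathfrak E)$, and $\Phi^{\mathfrak E}(\mathfrak F)$ is the class of morphisms $\psi$ in $\mathcal A$ with $\psi h\in\Sigma^{-1}\Phi(\mathfrak F)$ for all (composable) $h\in\Sigma^{-1}\Phi(\mathfrak E)$. These are ideals in $\mathcal A$. For an ideal $\mathcal I$ in $\mathcal A$, $\mathfrak{PB}_{\mathfrak E}(\mathcal I)$ is the class of $n$-angles in $\mathfrak E$ whose phantom can be written as $\psi i$ with $i\in\mathcal I$ and $\psi\in\Phi(\mathfrak E)$, and $\mathfrak{PO}_{\mathfrak E}(\mathcal I)$ is the class of $n$-angles in $\mathfrak E$ whose phantom can be written as $(\Sigma j)\psi$ with $j\in\mathcal I$ and $\psi\in\Phi(\mathfrak E)$. These are almost $n$-exact structures for $\mathcal A$ included in $\mathfrak E$. *)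

theory Defs
  imports "HOL-Algebra.Group" "HOL-Algebra.Galois_Connection"
begin

section \<open>Additive categories\<close>

record ('o, 'm) category_data =
  Obj :: "'o set"
  Arr :: "'m set"
  Dom :: "'m \<Rightarrow> 'o"
  Cod :: "'m \<Rightarrow> 'o"
  Id :: "'o \<Rightarrow> 'm"
  Comp :: "'m \<Rightarrow> 'm \<Rightarrow> 'm"  (infixr \<open>\<cdot>\<index>\<close> 70)

definition Hom :: "('o, 'm, 'e) category_data_scheme \<Rightarrow> 'o \<Rightarrow> 'o \<Rightarrow> 'm set" where
  "Hom C X Y = {f \<in> Arr C. Dom C f = X \<and> Cod C f = Y}"

text \<open>Composition is written in the order of application: \<open>g \<cdot> f\<close> is \<open>f\<close> followed by \<open>g\<close>.\<close>

locale category =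
  fixes C (structure)
  assumes Dom_closed: "f \<in> Arr C \<Longrightarrow> Dom C f \<in> Obj C"
    and Cod_closed: "f \<in> Arr C \<Longrightarrow> Cod C f \<in> Obj C"
    and Id_closed: "X \<in> Obj C \<Longrightarrow> Id C X \<in> Hom C X X"
    and Comp_closed: "f \<in> Hom C X Y \<Longrightarrow> g \<in> Hom C Y Z \<Longrightarrow> g \<cdot> f \<in> Hom C X Z"
    and Comp_assoc: "f \<in> Hom C W X \<Longrightarrow> g \<in> Hom C X Y \<Longrightarrow> h \<in> Hom C Y Z \<Longrightarrow>
      (h \<cdot> g) \<cdot> f = h \<cdot> (g \<cdot> f)"
    and Comp_Id: "f \<in> Hom C X Y \<Longrightarrow> f \<cdot> Id C X = f"
    and Id_Comp: "f \<in> Hom C X Y \<Longrightarrow> Id C Y \<cdot> f = f"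

definition isomorphic :: "('o, 'm, 'e) category_data_scheme \<Rightarrow> 'o \<Rightarrow> 'o \<Rightarrow> bool" where
  "isomorphic C X Y \<longleftrightarrow>
    (\<exists>f \<in> Hom C X Y. \<exists>g \<in> Hom C Y X. g \<cdot>\<^bsub>C\<^esub> f = Id C X \<and> f \<cdot>\<^bsub>C\<^esub> g = Id C Y)"

definition is_zero_object :: "('o, 'm, 'e) category_data_scheme \<Rightarrow> 'o \<Rightarrow> bool" where
  "is_zero_object C Z \<longleftrightarrow> Z \<in> Obj C \<and>
    (\<forall>X \<in> Obj C. (\<exists>!f. f \<in> Hom C Z X) \<and> (\<exists>!f. f \<in> Hom C X Z))"

record ('o, 'm) preadditive_data = "('o, 'm) category_data" +
  Add :: "'m \<Rightarrow> 'm \<Rightarrow> 'm"  (infixl \<open>\<boxplus>\<index>\<close> 65)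
  Zero :: "'o \<Rightarrow> 'o \<Rightarrow> 'm"

definition hom_group :: "('o, 'm, 'e) preadditive_data_scheme \<Rightarrow> 'o \<Rightarrow> 'o \<Rightarrow> 'm monoid" where
  "hom_group C X Y = \<lparr>carrier = Hom C X Y, monoid.mult = Add C, one = Zero C X Y\<rparr>"

definition Neg :: "('o, 'm, 'e) preadditive_data_scheme \<Rightarrow> 'm \<Rightarrow> 'm" where
  "Neg C f = inv\<^bsub>hom_group C (Dom C f) (Cod C f)\<^esub> f"

locale preadditive_category = category +
  assumes comm_group_hom: "X \<in> Obj C \<Longrightarrow> Y \<in> Obj C \<Longrightarrow> comm_group (hom_group C X Y)"
    and Comp_Add: "f \<in> Hom C X Y \<Longrightarrow> f' \<in> Hom C X Y \<Longrightarrow> g \<in> Hom C Y Z \<Longrightarrow>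
      g \<cdot> (f \<boxplus> f') = (g \<cdot> f) \<boxplus> (g \<cdot> f')"
    and Add_Comp: "f \<in> Hom C X Y \<Longrightarrow> g \<in> Hom C Y Z \<Longrightarrow> g' \<in> Hom C Y Z \<Longrightarrow>
      (g \<boxplus> g') \<cdot> f = (g \<cdot> f) \<boxplus> (g' \<cdot> f)"

definition is_biproduct ::
  "('o, 'm, 'e) preadditive_data_scheme \<Rightarrow> 'o \<Rightarrow> 'o \<Rightarrow> 'o \<Rightarrow> 'm \<Rightarrow> 'm \<Rightarrow> 'm \<Rightarrow> 'm \<Rightarrow> bool" where
  "is_biproduct C X Y P \<iota>1 \<iota>2 \<pi>1 \<pi>2 \<longleftrightarrow>
    P \<in> Obj C \<and>
    \<iota>1 \<in> Hom C X P \<and> \<iota>2 \<in> Hom C Y P \<and> \<pi>1 \<in> Hom C P X \<and> \<pi>2 \<in> Hom C P Y \<and>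
    \<pi>1 \<cdot>\<^bsub>C\<^esub> \<iota>1 = Id C X \<and> \<pi>2 \<cdot>\<^bsub>C\<^esub> \<iota>2 = Id C Y \<and>
    \<pi>2 \<cdot>\<^bsub>C\<^esub> \<iota>1 = Zero C X Y \<and> \<pi>1 \<cdot>\<^bsub>C\<^esub> \<iota>2 = Zero C Y X \<and>
    (\<iota>1 \<cdot>\<^bsub>C\<^esub> \<pi>1) \<boxplus>\<^bsub>C\<^esub> (\<iota>2 \<cdot>\<^bsub>C\<^esub> \<pi>2) = Id C P"

locale additive_category = preadditive_category +
  assumes ex_zero_object: "\<exists>Z. is_zero_object C Z"
    and ex_biproduct: "X \<in> Obj C \<Longrightarrow> Y \<in> Obj C \<Longrightarrow>
      \<exists>P \<iota>1 \<iota>2 \<pi>1 \<pi>2. is_biproduct C X Y P \<iota>1 \<iota>2 \<pi>1 \<pi>2"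

text \<open>The morphism with matrix \<open>(a b; c d)\<close>, where \<open>\<pi>1\<close>, \<open>\<pi>2\<close> are the projections of the source
  and \<open>\<iota>1\<close>, \<open>\<iota>2\<close> the injections of the target.\<close>

definition matrix_mor ::
  "('o, 'm, 'e) preadditive_data_scheme \<Rightarrow> 'm \<Rightarrow> 'm \<Rightarrow> 'm \<Rightarrow> 'm \<Rightarrow> 'm \<Rightarrow> 'm \<Rightarrow> 'm \<Rightarrow> 'm \<Rightarrow> 'm" where
  "matrix_mor C \<iota>1 \<iota>2 \<pi>1 \<pi>2 a b c d =
    ((\<iota>1 \<cdot>\<^bsub>C\<^esub> a \<cdot>\<^bsub>C\<^esub> \<pi>1) \<boxplus>\<^bsub>C\<^esub> (\<iota>1 \<cdot>\<^bsub>C\<^esub> b \<cdot>\<^bsub>C\<^esub> \<pi>2)) \<boxplus>\<^bsub>C\<^esub>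
    ((\<iota>2 \<cdot>\<^bsub>C\<^esub> c \<cdot>\<^bsub>C\<^esub> \<pi>1) \<boxplus>\<^bsub>C\<^esub> (\<iota>2 \<cdot>\<^bsub>C\<^esub> d \<cdot>\<^bsub>C\<^esub> \<pi>2))"


section \<open>\<open>n\<close>-angulated categories\<close>

text \<open>\<open>SusO\<close> and \<open>SusA\<close> are the object and arrow parts of the automorphism \<open>\<Sigma>\<close>. A sequence
  \<open>A\<^sub>1 \<rightarrow> \<dots> \<rightarrow> A\<^sub>n \<rightarrow> \<Sigma> A\<^sub>1\<close> is the list of its \<open>n\<close> morphisms, its objects being their domains.
  List positions start at \<open>0\<close>, so \<open>\<alpha> ! i\<close> is the morphism \<open>\<alpha>\<^sub>i\<^sub>+\<^sub>1\<close>.\<close>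

record ('o, 'm) angulated_data = "('o, 'm) preadditive_data" +
  SusO :: "'o \<Rightarrow> 'o"
  SusA :: "'m \<Rightarrow> 'm"
  Angles :: "'m list set"

text \<open>\<open>wrap T [x\<^sub>1, \<dots>, x\<^sub>n] = [x\<^sub>1, \<dots>, x\<^sub>n, \<Sigma> x\<^sub>1]\<close>: it adds the component at the
  last term \<open>\<Sigma> A\<^sub>1\<close>.\<close>

definition wrap :: "('o, 'm, 'e) angulated_data_scheme \<Rightarrow> 'm list \<Rightarrow> 'm list" where
  "wrap T xs = xs @ [SusA T (hd xs)]"

definition is_seq :: "('o, 'm, 'e) angulated_data_scheme \<Rightarrow> nat \<Rightarrow> 'm list \<Rightarrow> bool" where
  "is_seq T n \<alpha> \<longleftrightarrow> length \<alpha> = n \<and> set \<alpha> \<subseteq> Arr T \<and>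
    (\<forall>i < n. Cod T (\<alpha> ! i) = Dom T (wrap T \<alpha> ! Suc i))"

definition is_seq_mor ::
  "('o, 'm, 'e) angulated_data_scheme \<Rightarrow> nat \<Rightarrow> 'm list \<Rightarrow> 'm list \<Rightarrow> 'm list \<Rightarrow> bool" where
  "is_seq_mor T n \<alpha> \<beta> \<phi> \<longleftrightarrow> length \<phi> = n \<and>
    (\<forall>i < n. \<phi> ! i \<in> Hom T (Dom T (\<alpha> ! i)) (Dom T (\<beta> ! i)) \<and>
      wrap T \<phi> ! Suc i \<cdot>\<^bsub>T\<^esub> \<alpha> ! i = \<beta> ! i \<cdot>\<^bsub>T\<^esub> \<phi> ! i)"

text \<open>\<open>\<gamma>\<close> is a sequence whose \<open>i\<close>-th object is some biproduct of \<open>X i\<close> and \<open>Y i\<close> and whose \<open>i\<close>-th map has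
  matrix \<open>(a i  b i; c i  d i)\<close>; the last term \<open>\<Sigma>(X 0 \<oplus> Y 0)\<close> carries the
  biproduct structure obtained by applying \<open>\<Sigma>\<close>.\<close>

definition is_matrix_seq ::
  "('o, 'm, 'e) angulated_data_scheme \<Rightarrow> nat \<Rightarrow> (nat \<Rightarrow> 'o) \<Rightarrow> (nat \<Rightarrow> 'o) \<Rightarrow>
    (nat \<Rightarrow> 'm) \<Rightarrow> (nat \<Rightarrow> 'm) \<Rightarrow> (nat \<Rightarrow> 'm) \<Rightarrow> (nat \<Rightarrow> 'm) \<Rightarrow> 'm list \<Rightarrow> bool" where
  "is_matrix_seq T n X Y a b c d \<gamma> \<longleftrightarrow> is_seq T n \<gamma> \<and>
    (\<exists>\<iota>1 \<iota>2 \<pi>1 \<pi>2. length \<iota>1 = n \<and> length \<iota>2 = n \<and> length \<pi>1 = n \<and> length \<pi>2 = n \<and>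
      (\<forall>i < n.
        is_biproduct T (X i) (Y i) (Dom T (\<gamma> ! i)) (\<iota>1 ! i) (\<iota>2 ! i) (\<pi>1 ! i) (\<pi>2 ! i) \<and>
        \<gamma> ! i = matrix_mor T (wrap T \<iota>1 ! Suc i) (wrap T \<iota>2 ! Suc i) (\<pi>1 ! i) (\<pi>2 ! i)
          (a i) (b i) (c i) (d i)))"

text \<open>Direct sums are meant up to the choice of the biproducts, so a class closed under them is
  independent of that choice.\<close>

definition is_direct_sum ::
  "('o, 'm, 'e) angulated_data_scheme \<Rightarrow> nat \<Rightarrow> 'm list \<Rightarrow> 'm list \<Rightarrow> 'm list \<Rightarrow> bool" where
  "is_direct_sum T n \<alpha> \<beta> \<gamma> \<longleftrightarrow> is_seq T n \<alpha> \<and> is_seq T n \<beta> \<and>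
    is_matrix_seq T n (\<lambda>i. Dom T (\<alpha> ! i)) (\<lambda>i. Dom T (\<beta> ! i))
      (\<lambda>i. \<alpha> ! i) (\<lambda>i. Zero T (Dom T (\<beta> ! i)) (Cod T (\<alpha> ! i)))
      (\<lambda>i. Zero T (Dom T (\<alpha> ! i)) (Cod T (\<beta> ! i))) (\<lambda>i. \<beta> ! i) \<gamma>"

definition is_cone ::
  "('o, 'm, 'e) angulated_data_scheme \<Rightarrow> nat \<Rightarrow> 'm list \<Rightarrow> 'm list \<Rightarrow> 'm list \<Rightarrow> 'm list \<Rightarrow> bool" where
  "is_cone T n \<alpha> \<beta> \<phi> \<gamma> \<longleftrightarrow>
    is_matrix_seq T n (\<lambda>i. Dom T (wrap T \<alpha> ! Suc i)) (\<lambda>i. Dom T (\<beta> ! i))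
      (\<lambda>i. Neg T (wrap T \<alpha> ! Suc i))
      (\<lambda>i. Zero T (Dom T (\<beta> ! i)) (Cod T (wrap T \<alpha> ! Suc i)))
      (\<lambda>i. wrap T \<phi> ! Suc i) (\<lambda>i. \<beta> ! i) \<gamma>"

definition left_rotation :: "('o, 'm, 'e) angulated_data_scheme \<Rightarrow> nat \<Rightarrow> 'm list \<Rightarrow> 'm list" where
  "left_rotation T n \<alpha> =
    tl \<alpha> @ [if even n then SusA T (hd \<alpha>) else Neg T (SusA T (hd \<alpha>))]"

definition trivial_seq :: "('o, 'm, 'e) angulated_data_scheme \<Rightarrow> nat \<Rightarrow> 'o \<Rightarrow> 'o \<Rightarrow> 'm list" where
  "trivial_seq T n Z X =
    [Id T X, Zero T X Z] @ replicate (n - 3) (Zero T Z Z) @ [Zero T Z (SusO T X)]"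

text \<open>The automorphism is an automorphism of the additive category, hence additive on
  morphisms.\<close>

locale n_angulated_category = additive_category T for T (structure) +
  fixes n :: nat
  assumes n_ge_3: "3 \<le> n"
    and SusO_bij: "bij_betw (SusO T) (Obj T) (Obj T)"
    and SusA_bij: "bij_betw (SusA T) (Arr T) (Arr T)"
    and SusA_Hom: "f \<in> Hom T X Y \<Longrightarrow> SusA T f \<in> Hom T (SusO T X) (SusO T Y)"
    and SusA_Id: "X \<in> Obj T \<Longrightarrow> SusA T (Id T X) = Id T (SusO T X)"
    and SusA_Comp: "f \<in> Hom T X Y \<Longrightarrow> g \<in> Hom T Y Z \<Longrightarrow> SusA T (g \<cdot> f) = SusA T g \<cdot> SusA T f"
    and SusA_Add: "f \<in> Hom T X Y \<Longrightarrow> g \<in> Hom T X Y \<Longrightarrow> SusA T (f \<boxplus> g) = SusA T f \<boxplus> SusA T g"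
    and Angles_seq: "\<alpha> \<in> Angles T \<Longrightarrow> is_seq T n \<alpha>"
    and F1_direct_sum: "\<alpha> \<in> Angles T \<Longrightarrow> \<beta> \<in> Angles T \<Longrightarrow> is_direct_sum T n \<alpha> \<beta> \<gamma> \<Longrightarrow>
      \<gamma> \<in> Angles T"
    and F1_direct_summand: "\<gamma> \<in> Angles T \<Longrightarrow> is_direct_sum T n \<alpha> \<beta> \<gamma> \<Longrightarrow>
      \<alpha> \<in> Angles T \<and> \<beta> \<in> Angles T"
    and F1_trivial: "X \<in> Obj T \<Longrightarrow> is_zero_object T Z \<Longrightarrow> trivial_seq T n Z X \<in> Angles T"
    and F1_first: "f \<in> Arr T \<Longrightarrow> \<exists>\<alpha> \<in> Angles T. hd \<alpha> = f"
    and F2: "is_seq T n \<alpha> \<Longrightarrow> \<alpha> \<in> Angles T \<longleftrightarrow> left_rotation T n \<alpha> \<in> Angles T"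
    and F3: "\<alpha> \<in> Angles T \<Longrightarrow> \<beta> \<in> Angles T \<Longrightarrow>
      f \<in> Hom T (Dom T (\<alpha> ! 0)) (Dom T (\<beta> ! 0)) \<Longrightarrow>
      g \<in> Hom T (Dom T (\<alpha> ! 1)) (Dom T (\<beta> ! 1)) \<Longrightarrow>
      g \<cdot> \<alpha> ! 0 = \<beta> ! 0 \<cdot> f \<Longrightarrow>
      \<exists>\<phi>. is_seq_mor T n \<alpha> \<beta> \<phi> \<and> \<phi> ! 0 = f \<and> \<phi> ! 1 = g"
    and F4: "\<alpha> \<in> Angles T \<Longrightarrow> \<beta> \<in> Angles T \<Longrightarrow>
      f \<in> Hom T (Dom T (\<alpha> ! 0)) (Dom T (\<beta> ! 0)) \<Longrightarrow>
      g \<in> Hom T (Dom T (\<alpha> ! 1)) (Dom T (\<beta> ! 1)) \<Longrightarrow>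
      g \<cdot> \<alpha> ! 0 = \<beta> ! 0 \<cdot> f \<Longrightarrow>
      \<exists>\<phi>. is_seq_mor T n \<alpha> \<beta> \<phi> \<and> \<phi> ! 0 = f \<and> \<phi> ! 1 = g \<and>
        (\<exists>\<gamma> \<in> Angles T. is_cone T n \<alpha> \<beta> \<phi> \<gamma>)"

definition is_split :: "('o, 'm, 'e) angulated_data_scheme \<Rightarrow> 'm list \<Rightarrow> bool" where
  "is_split T \<alpha> \<longleftrightarrow> last \<alpha> = Zero T (Dom T (last \<alpha>)) (Cod T (last \<alpha>))"


section \<open>Almost \<open>n\<close>-exact structures\<close>

text \<open>A full subcategory is given by its set of objects \<open>A\<close>.\<close>

definition ext_closed_subcategory ::
  "('o, 'm, 'e) angulated_data_scheme \<Rightarrow> nat \<Rightarrow> 'o set \<Rightarrow> bool" where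
  "ext_closed_subcategory T n A \<longleftrightarrow> A \<subseteq> Obj T \<and>
    (\<forall>X \<in> A. \<forall>Y \<in> Obj T. isomorphic T X Y \<longrightarrow> Y \<in> A) \<and>
    (\<forall>\<alpha> \<in> Angles T. Dom T (hd \<alpha>) \<in> A \<and> Dom T (last \<alpha>) \<in> A \<longrightarrow> (\<forall>i < n. Dom T (\<alpha> ! i) \<in> A))"

definition angles_in :: "('o, 'm, 'e) angulated_data_scheme \<Rightarrow> nat \<Rightarrow> 'o set \<Rightarrow> 'm list set" where
  "angles_in T n A = {\<alpha> \<in> Angles T. \<forall>i < n. Dom T (\<alpha> ! i) \<in> A}"

definition almost_n_exact ::
  "('o, 'm, 'e) angulated_data_scheme \<Rightarrow> nat \<Rightarrow> 'o set \<Rightarrow> 'm list set \<Rightarrow> bool" where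
  "almost_n_exact T n A E \<longleftrightarrow> E \<subseteq> angles_in T n A \<and>
    (\<forall>\<alpha> \<in> E. \<forall>\<beta> \<in> E. \<forall>\<gamma>. is_direct_sum T n \<alpha> \<beta> \<gamma> \<longrightarrow> \<gamma> \<in> E) \<and>
    (\<forall>\<alpha> \<in> angles_in T n A. is_split T \<alpha> \<longrightarrow> \<alpha> \<in> E) \<and>
    (\<forall>\<alpha> \<in> E. \<forall>B \<in> A. \<forall>f \<in> Hom T B (Dom T (last \<alpha>)). \<forall>\<beta> \<in> Angles T.
      Dom T (hd \<beta>) = Dom T (hd \<alpha>) \<and> last \<beta> = last \<alpha> \<cdot>\<^bsub>T\<^esub> f \<and>
      (\<exists>\<phi>. is_seq_mor T n \<beta> \<alpha> \<phi> \<and> hd \<phi> = Id T (Dom T (hd \<alpha>)) \<and> last \<phi> = f) \<longrightarrow> \<beta> \<in> E) \<and>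
    (\<forall>\<alpha> \<in> E. \<forall>C \<in> A. \<forall>g \<in> Hom T (Dom T (hd \<alpha>)) C. \<forall>\<beta> \<in> Angles T.
      Dom T (hd \<beta>) = C \<and> last \<beta> = SusA T g \<cdot>\<^bsub>T\<^esub> last \<alpha> \<and>
      (\<exists>\<phi>. is_seq_mor T n \<alpha> \<beta> \<phi> \<and> hd \<phi> = g \<and> last \<phi> = Id T (Dom T (last \<alpha>))) \<longrightarrow> \<beta> \<in> E)"

definition phantoms :: "'m list set \<Rightarrow> 'm set" where
  "phantoms E = last ` E"

text \<open>The class \<open>\<Sigma>\<^sup>-\<^sup>1 \<Phi>(E)\<close>, written as a preimage since \<open>\<Sigma>\<close> is bijective.\<close>

definition desuspended_phantoms ::
  "('o, 'm, 'e) angulated_data_scheme \<Rightarrow> 'm list set \<Rightarrow> 'm set" where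
  "desuspended_phantoms T E = {f \<in> Arr T. SusA T f \<in> phantoms E}"


section \<open>Ideals and the four correspondences\<close>

definition sub_arrows :: "('o, 'm, 'e) category_data_scheme \<Rightarrow> 'o set \<Rightarrow> 'm set" where
  "sub_arrows C A = {f \<in> Arr C. Dom C f \<in> A \<and> Cod C f \<in> A}"

text \<open>Subfunctors of the bifunctor \<open>Hom\<close> into abelian groups: subgroups of all hom groups, stable
  under composition with morphisms of the full subcategory on both sides.\<close>

definition is_ideal :: "('o, 'm, 'e) preadditive_data_scheme \<Rightarrow> 'o set \<Rightarrow> 'm set \<Rightarrow> bool" where
  "is_ideal C A I \<longleftrightarrow> I \<subseteq> sub_arrows C A \<and>
    (\<forall>X \<in> A. \<forall>Y \<in> A. subgroup (I \<inter> Hom C X Y) (hom_group C X Y)) \<and>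
    (\<forall>i \<in> I. \<forall>f \<in> sub_arrows C A. Cod C f = Dom C i \<longrightarrow> i \<cdot>\<^bsub>C\<^esub> f \<in> I) \<and>
    (\<forall>i \<in> I. \<forall>g \<in> sub_arrows C A. Dom C g = Cod C i \<longrightarrow> g \<cdot>\<^bsub>C\<^esub> i \<in> I)"

definition Ideals :: "('o, 'm, 'e) preadditive_data_scheme \<Rightarrow> 'o set \<Rightarrow> 'm set set" where
  "Ideals C A = {I. is_ideal C A I}"

definition Ex_str ::
  "('o, 'm, 'e) angulated_data_scheme \<Rightarrow> nat \<Rightarrow> 'o set \<Rightarrow> 'm list set \<Rightarrow> 'm list set set" where
  "Ex_str T n A E = {F. almost_n_exact T n A F \<and> F \<subseteq> E}"

definition Phi_lower ::
  "('o, 'm, 'e) angulated_data_scheme \<Rightarrow> 'o set \<Rightarrow> 'm list set \<Rightarrow> 'm list set \<Rightarrow> 'm set" where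
  "Phi_lower T A E F = {\<phi> \<in> sub_arrows T A.
    \<forall>h \<in> phantoms E. Dom T h = Cod T \<phi> \<longrightarrow> h \<cdot>\<^bsub>T\<^esub> \<phi> \<in> phantoms F}"

definition Phi_upper ::
  "('o, 'm, 'e) angulated_data_scheme \<Rightarrow> 'o set \<Rightarrow> 'm list set \<Rightarrow> 'm list set \<Rightarrow> 'm set" where
  "Phi_upper T A E F = {\<psi> \<in> sub_arrows T A.
    \<forall>h \<in> desuspended_phantoms T E. Dom T \<psi> = Cod T h \<longrightarrow> \<psi> \<cdot>\<^bsub>T\<^esub> h \<in> desuspended_phantoms T F}"

definition PB ::
  "('o, 'm, 'e) angulated_data_scheme \<Rightarrow> 'm list set \<Rightarrow> 'm set \<Rightarrow> 'm list set" where
  "PB T E I = {\<alpha> \<in> E. \<exists>i \<in> I. \<exists>\<psi> \<in> phantoms E. Dom T \<psi> = Cod T i \<and> last \<alpha> = \<psi> \<cdot>\<^bsub>T\<^esub> i}"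

definition PO ::
  "('o, 'm, 'e) angulated_data_scheme \<Rightarrow> 'm list set \<Rightarrow> 'm set \<Rightarrow> 'm list set" where
  "PO T E I = {\<alpha> \<in> E. \<exists>j \<in> I. \<exists>\<psi> \<in> phantoms E.
    Dom T (SusA T j) = Cod T \<psi> \<and> last \<alpha> = SusA T j \<cdot>\<^bsub>T\<^esub> \<psi>}"

definition inclusion_order :: "'a set set \<Rightarrow> 'a set gorder" where
  "inclusion_order S = \<lparr>carrier = S, eq = (=), le = (\<subseteq>)\<rparr>"

end

theory Submission
  imports Defs
begin

text \<open>
  An almost \<open>n\<close>-exact structure is determined by its phantoms. Rotating the axioms, every morphism
  \<open>X \<rightarrow> \<Sigma> Y\<close> is the last map of some \<open>n\<close>-angle starting at \<open>Y\<close>, and every commutative square between last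
  maps extends to a morphism of \<open>n\<close>-angles. Hence (N2), applied to an identity, puts every \<open>n\<close>-angle whose last
  map is a phantom into the structure, and (N1)--(N3) say exactly that the phantoms form an additive
  subfunctor of \<open>Hom(-, \<Sigma> -)\<close> on \<open>A\<close>. In these terms \<open>PB\<close> and \<open>PO\<close> are products of an ideal with
  the phantoms, \<open>Phi_lower\<close> and \<open>Phi_upper\<close> are residuals, and a product is adjoint to its residual.
\<close>

section \<open>Preadditive categories\<close>

text \<open>Once phantoms are available the two equivalences are short; most of the work is to show
  that the four maps land where a Galois connection requires, in \<open>Ex_str T n A E\<close> and
  in \<open>Ideals T A\<close>. The critical point there is addition. A product of an ideal with the
  phantoms consists of single composites \<psi> i, and a sum \<psi> i + \<psi>' i' has to be such a
  composite again. It is rewritten as the row (\<psi>, \<psi>') after the column (i, i'), through a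
  biproduct of the two middle objects. That biproduct must lie in \<open>A\<close>, which is
  extracted from the closure of the structure under direct sums. The other recurring obstacle is the
  sign (-1)^n of the rotation axiom; it is bundled into one involution, \<open>signed\<close>,
  compatible with composition and \<Sigma>.\<close>

lemma HomI: "f \<in> Arr C \<Longrightarrow> f \<in> Hom C (Dom C f) (Cod C f)"
  by (simp add: Hom_def)

lemma HomD: "f \<in> Hom C X Y \<Longrightarrow> f \<in> Arr C \<and> Dom C f = X \<and> Cod C f = Y"
  by (simp add: Hom_def)

context preadditive_category
begin

lemma Hom_Obj: "f \<in> Hom C X Y \<Longrightarrow> X \<in> Obj C \<and> Y \<in> Obj C"
  using Dom_closed Cod_closed by (auto simp: Hom_def)

lemma Add_closed: "f \<in> Hom C X Y \<Longrightarrow> g \<in> Hom C X Y \<Longrightarrow> f \<boxplus> g \<in> Hom C X Y"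
  using monoid.m_closed[of "hom_group C X Y" f g] comm_group_hom[of X Y] Hom_Obj[of f X Y]
  by (simp add: hom_group_def comm_group_def group_def)

lemma Zero_closed: "X \<in> Obj C \<Longrightarrow> Y \<in> Obj C \<Longrightarrow> Zero C X Y \<in> Hom C X Y"
  using monoid.one_closed[of "hom_group C X Y"] comm_group_hom[of X Y]
  by (simp add: hom_group_def comm_group_def group_def)

lemma Zero_Add: "f \<in> Hom C X Y \<Longrightarrow> Zero C X Y \<boxplus> f = f"
  using monoid.l_one[of "hom_group C X Y" f] comm_group_hom[of X Y] Hom_Obj[of f X Y]
  by (simp add: hom_group_def comm_group_def group_def)

lemma Add_Zero: "f \<in> Hom C X Y \<Longrightarrow> f \<boxplus> Zero C X Y = f"
  using monoid.r_one[of "hom_group C X Y" f] comm_group_hom[of X Y] Hom_Obj[of f X Y]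
  by (simp add: hom_group_def comm_group_def group_def)

lemma Neg_closed: "f \<in> Hom C X Y \<Longrightarrow> Neg C f \<in> Hom C X Y"
  using group.inv_closed[of "hom_group C X Y" f] comm_group_hom[of X Y] Hom_Obj[of f X Y]
  by (auto simp: hom_group_def comm_group_def Neg_def Hom_def)

lemma Add_Neg: "f \<in> Hom C X Y \<Longrightarrow> f \<boxplus> Neg C f = Zero C X Y"
  using group.r_inv[of "hom_group C X Y" f] comm_group_hom[of X Y] Hom_Obj[of f X Y]
  by (auto simp: hom_group_def comm_group_def Neg_def Hom_def)

lemma Neg_unique:
  assumes "f \<in> Hom C X Y" "g \<in> Hom C X Y" "f \<boxplus> g = Zero C X Y"
  shows "g = Neg C f"
proof -
  interpret comm_group "hom_group C X Y"
    using comm_group_hom Hom_Obj[OF assms(1)] by blast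
  have "inv\<^bsub>hom_group C X Y\<^esub> g = f"
    using assms by (intro inv_equality) (auto simp: hom_group_def)
  then have "g = inv\<^bsub>hom_group C X Y\<^esub> f"
    using inv_inv[of g] assms by (simp add: hom_group_def)
  then show ?thesis
    using assms(1) by (auto simp: Neg_def Hom_def)
qed

text \<open>Cancellation in the hom group. An additive map sends zero to some f with f + f = f, so
  this one fact makes composition on either side, and later \<Sigma>, preserve zero
  morphisms.\<close>

lemma Zero_unique:
  assumes "f \<in> Hom C X Y" "f \<boxplus> f = f"
  shows "f = Zero C X Y"
proof -
  interpret comm_group "hom_group C X Y"
    using comm_group_hom Hom_Obj[OF assms(1)] by blast
  show ?thesis
    using l_cancel_one[of f f] assms by (simp add: hom_group_def)
qed

lemma Neg_Neg: "f \<in> Hom C X Y \<Longrightarrow> Neg C (Neg C f) = f"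
proof -
  assume f: "f \<in> Hom C X Y"
  interpret comm_group "hom_group C X Y"
    using comm_group_hom Hom_Obj[OF f] by blast
  have "Neg C f \<boxplus> f = Zero C X Y"
    using l_inv[of f] f by (auto simp: hom_group_def Neg_def Hom_def)
  then show ?thesis
    using Neg_unique[OF Neg_closed[OF f] f] by simp
qed

lemma Comp_Zero:
  assumes "X \<in> Obj C" "g \<in> Hom C Y Z"
  shows "g \<cdot> Zero C X Y = Zero C X Z"
proof -
  have z: "Zero C X Y \<in> Hom C X Y"
    using assms Hom_Obj Zero_closed by blast
  show ?thesis
    using Comp_Add[OF z z assms(2)] Zero_Add[OF z] Comp_closed[OF z assms(2)]
    by (intro Zero_unique) auto
qed

lemma Zero_Comp:
  assumes "f \<in> Hom C X Y" "Z \<in> Obj C"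
  shows "Zero C Y Z \<cdot> f = Zero C X Z"
proof -
  have z: "Zero C Y Z \<in> Hom C Y Z"
    using assms Hom_Obj Zero_closed by blast
  show ?thesis
    using Add_Comp[OF assms(1) z z] Zero_Add[OF z] Comp_closed[OF assms(1) z]
    by (intro Zero_unique) auto
qed

lemma Comp_Neg:
  assumes "f \<in> Hom C X Y" "g \<in> Hom C Y Z"
  shows "g \<cdot> Neg C f = Neg C (g \<cdot> f)"
  using assms Comp_Add[OF assms(1) Neg_closed[OF assms(1)] assms(2)]
    Add_Neg[OF assms(1)] Comp_Zero[OF _ assms(2)] Hom_Obj[OF assms(1)]
  by (intro Neg_unique) (auto intro: Comp_closed Neg_closed)

lemma Neg_Comp:
  assumes "f \<in> Hom C X Y" "g \<in> Hom C Y Z"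
  shows "Neg C g \<cdot> f = Neg C (g \<cdot> f)"
  using assms Add_Comp[OF assms(1) assms(2) Neg_closed[OF assms(2)]]
    Add_Neg[OF assms(2)] Zero_Comp[OF assms(1)] Hom_Obj[OF assms(2)]
  by (intro Neg_unique) (auto intro: Comp_closed Neg_closed)

lemma matrix_mor_closed:
  assumes "\<pi>1 \<in> Hom C P X" "\<pi>2 \<in> Hom C P Y" "\<iota>1 \<in> Hom C X' Q" "\<iota>2 \<in> Hom C Y' Q"
    and "a \<in> Hom C X X'" "b \<in> Hom C Y X'" "c \<in> Hom C X Y'" "d \<in> Hom C Y Y'"
  shows "matrix_mor C \<iota>1 \<iota>2 \<pi>1 \<pi>2 a b c d \<in> Hom C P Q"
  unfolding matrix_mor_def using assms by (meson Add_closed Comp_closed)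

text \<open>The two off-diagonal summands factor through zero morphisms and vanish. Matrices of
  direct sums have this shape, and \<open>direct_sum_last\<close> relies on the resulting two-term
  formula.\<close>

lemma matrix_mor_diagonal:
  assumes "\<pi>1 \<in> Hom C P X" "\<pi>2 \<in> Hom C P Y" "\<iota>1 \<in> Hom C X' Q" "\<iota>2 \<in> Hom C Y' Q"
    and "a \<in> Hom C X X'" "d \<in> Hom C Y Y'"
  shows "matrix_mor C \<iota>1 \<iota>2 \<pi>1 \<pi>2 a (Zero C Y X') (Zero C X Y') d =
    (\<iota>1 \<cdot> a \<cdot> \<pi>1) \<boxplus> (\<iota>2 \<cdot> d \<cdot> \<pi>2)"
proof -
  have "\<iota>1 \<cdot> Zero C Y X' \<cdot> \<pi>2 = Zero C P Q" "\<iota>2 \<cdot> Zero C X Y' \<cdot> \<pi>1 = Zero C P Q"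
    using assms Hom_Obj by (metis Zero_Comp Comp_Zero)+
  moreover have "\<iota>1 \<cdot> a \<cdot> \<pi>1 \<in> Hom C P Q" "\<iota>2 \<cdot> d \<cdot> \<pi>2 \<in> Hom C P Q"
    using assms by (meson Comp_closed)+
  ultimately show ?thesis
    by (simp add: matrix_mor_def Add_Zero Zero_Add)
qed

section \<open>Ideals in terms of typed morphisms\<close>

lemma is_ideal_facts:
  assumes "is_ideal C A I"
  shows "I \<subseteq> sub_arrows C A"
    and "X \<in> A \<Longrightarrow> Y \<in> A \<Longrightarrow> Zero C X Y \<in> I"
    and "f \<in> I \<Longrightarrow> g \<in> I \<Longrightarrow> f \<in> Hom C X Y \<Longrightarrow> g \<in> Hom C X Y \<Longrightarrow> f \<boxplus> g \<in> I"
    and "i \<in> I \<Longrightarrow> i \<in> Hom C X Y \<Longrightarrow> f \<in> Hom C B X \<Longrightarrow> B \<in> A \<Longrightarrow> i \<cdot> f \<in> I"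
    and "i \<in> I \<Longrightarrow> i \<in> Hom C X Y \<Longrightarrow> g \<in> Hom C Y Z \<Longrightarrow> Z \<in> A \<Longrightarrow> g \<cdot> i \<in> I"
proof -
  note i = assms[unfolded is_ideal_def]
  show sub: "I \<subseteq> sub_arrows C A" using i by blast
  have sg: "subgroup (I \<inter> Hom C X Y) (hom_group C X Y)" if "X \<in> A" "Y \<in> A" for X Y
    using i that by blast
  show "X \<in> A \<Longrightarrow> Y \<in> A \<Longrightarrow> Zero C X Y \<in> I"
    using subgroup.one_closed[OF sg] by (simp add: hom_group_def)
  show "f \<boxplus> g \<in> I" if "f \<in> I" "g \<in> I" "f \<in> Hom C X Y" "g \<in> Hom C X Y"
    using subgroup.m_closed[OF sg, of X Y f g] that sub
    by (auto simp: hom_group_def Hom_def sub_arrows_def)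
  show "i \<in> I \<Longrightarrow> i \<in> Hom C X Y \<Longrightarrow> f \<in> Hom C B X \<Longrightarrow> B \<in> A \<Longrightarrow> i \<cdot> f \<in> I"
    "i \<in> I \<Longrightarrow> i \<in> Hom C X Y \<Longrightarrow> g \<in> Hom C Y Z \<Longrightarrow> Z \<in> A \<Longrightarrow> g \<cdot> i \<in> I"
    using i[THEN conjunct2, THEN conjunct2] sub by (auto simp: Hom_def sub_arrows_def)
qed

text \<open>\<open>is_ideal\<close> speaks of bare arrows and of subgroups; here each closure is
  asked only for morphisms typed between objects of \<open>A\<close>, the form in which phantoms are
  handled later.\<close>

lemma is_idealI:
  assumes sub: "I \<subseteq> sub_arrows C A" and A: "A \<subseteq> Obj C"
    and Zero: "\<And>X Y. X \<in> A \<Longrightarrow> Y \<in> A \<Longrightarrow> Zero C X Y \<in> I"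
    and Add: "\<And>f g X Y. f \<in> I \<Longrightarrow> g \<in> I \<Longrightarrow> f \<in> Hom C X Y \<Longrightarrow> g \<in> Hom C X Y \<Longrightarrow>
      X \<in> A \<Longrightarrow> Y \<in> A \<Longrightarrow> f \<boxplus> g \<in> I"
    and Neg: "\<And>f X Y. f \<in> I \<Longrightarrow> f \<in> Hom C X Y \<Longrightarrow> X \<in> A \<Longrightarrow> Y \<in> A \<Longrightarrow> Neg C f \<in> I"
    and pre: "\<And>i f B X Y. i \<in> I \<Longrightarrow> i \<in> Hom C X Y \<Longrightarrow> f \<in> Hom C B X \<Longrightarrow>
      B \<in> A \<Longrightarrow> X \<in> A \<Longrightarrow> Y \<in> A \<Longrightarrow> i \<cdot> f \<in> I"
    and post: "\<And>i g X Y Z. i \<in> I \<Longrightarrow> i \<in> Hom C X Y \<Longrightarrow> g \<in> Hom C Y Z \<Longrightarrow>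
      X \<in> A \<Longrightarrow> Y \<in> A \<Longrightarrow> Z \<in> A \<Longrightarrow> g \<cdot> i \<in> I"
  shows "is_ideal C A I"
  unfolding is_ideal_def
proof (intro conjI ballI impI)
  show "I \<subseteq> sub_arrows C A" by (fact sub)
next
  fix X Y assume XY: "X \<in> A" "Y \<in> A"
  then have o: "X \<in> Obj C" "Y \<in> Obj C" using A by auto
  then interpret comm_group "hom_group C X Y" by (rule comm_group_hom)
  show "subgroup (I \<inter> Hom C X Y) (hom_group C X Y)"
  proof (rule subgroupI)
    show "I \<inter> Hom C X Y \<subseteq> carrier (hom_group C X Y)" by (simp add: hom_group_def)
    show "I \<inter> Hom C X Y \<noteq> {}" using Zero[OF XY] Zero_closed[OF o] by blast
    fix f assume f: "f \<in> I \<inter> Hom C X Y"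
    \<comment> \<open>\<open>Neg\<close> inverts in the hom group of the domain and codomain of f,
      which here is the group of X and Y.\<close>
    then have "inv\<^bsub>hom_group C X Y\<^esub> f = Neg C f" by (auto simp: Neg_def Hom_def)
    then show "inv\<^bsub>hom_group C X Y\<^esub> f \<in> I \<inter> Hom C X Y"
      using f Neg XY Neg_closed by auto
    fix g assume "g \<in> I \<inter> Hom C X Y"
    then show "f \<otimes>\<^bsub>hom_group C X Y\<^esub> g \<in> I \<inter> Hom C X Y"
      using f Add XY Add_closed by (auto simp: hom_group_def)
  qed
next
  fix i f assume "i \<in> I" "f \<in> sub_arrows C A" "Cod C f = Dom C i"
  then show "i \<cdot> f \<in> I"
    using sub pre[of i "Dom C i" "Cod C i" f "Dom C f"] by (auto simp: sub_arrows_def Hom_def)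
next
  fix i g assume "i \<in> I" "g \<in> sub_arrows C A" "Dom C g = Cod C i"
  then show "g \<cdot> i \<in> I"
    using sub post[of i "Dom C i" "Cod C i" g "Cod C g"] by (auto simp: sub_arrows_def Hom_def)
qed

end

section \<open>Rotations and direct sums of sequences\<close>

lemma wrap_nth_less: "i < length xs \<Longrightarrow> wrap T xs ! i = xs ! i"
  by (simp add: wrap_def nth_append)

lemma wrap_nth_length: "wrap T xs ! length xs = SusA T (hd xs)"
  by (simp add: wrap_def)

context n_angulated_category
begin

section \<open>The automorphism and the sign of the rotation axiom\<close>

lemma SusO_inj: "X \<in> Obj T \<Longrightarrow> Y \<in> Obj T \<Longrightarrow> SusO T X = SusO T Y \<Longrightarrow> X = Y"
  using SusO_bij by (auto simp: bij_betw_def inj_on_def)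

lemma SusO_closed: "X \<in> Obj T \<Longrightarrow> SusO T X \<in> Obj T"
  using SusO_bij by (auto simp: bij_betw_def)

lemma SusA_inj: "f \<in> Arr T \<Longrightarrow> g \<in> Arr T \<Longrightarrow> SusA T f = SusA T g \<Longrightarrow> f = g"
  using SusA_bij by (auto simp: bij_betw_def inj_on_def)

lemma Dom_Cod_SusA:
  "f \<in> Arr T \<Longrightarrow> SusA T f \<in> Arr T \<and> Dom T (SusA T f) = SusO T (Dom T f) \<and>
    Cod T (SusA T f) = SusO T (Cod T f)"
  using SusA_Hom[OF HomI] by (auto simp: Hom_def)

lemma SusA_surj:
  assumes "f \<in> Arr T"
  obtains f' where "f' \<in> Arr T" "SusA T f' = f"
proof -
  have "f \<in> SusA T ` Arr T"
    using SusA_bij assms by (simp add: bij_betw_def)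
  then show ?thesis
    using that by blast
qed

lemma SusA_Hom_iff:
  assumes "f \<in> Arr T" "X \<in> Obj T" "Y \<in> Obj T"
  shows "SusA T f \<in> Hom T (SusO T X) (SusO T Y) \<longleftrightarrow> f \<in> Hom T X Y"
  using assms Dom_Cod_SusA[of f] SusO_inj Dom_closed Cod_closed by (auto simp: Hom_def)

lemma SusA_Zero:
  assumes "X \<in> Obj T" "Y \<in> Obj T"
  shows "SusA T (Zero T X Y) = Zero T (SusO T X) (SusO T Y)"
proof -
  have z: "Zero T X Y \<in> Hom T X Y"
    using assms Zero_closed by blast
  show ?thesis
    using SusA_Add[OF z z] Zero_Add[OF z] SusA_Hom[OF z] by (intro Zero_unique) auto
qed

lemma SusA_Neg:
  assumes "f \<in> Hom T X Y"
  shows "SusA T (Neg T f) = Neg T (SusA T f)"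
  using SusA_Add[OF assms Neg_closed[OF assms]] Add_Neg[OF assms] SusA_Zero Hom_Obj[OF assms]
  by (intro Neg_unique[OF SusA_Hom[OF assms] SusA_Hom[OF Neg_closed[OF assms]]]) auto

text \<open>Multiplication by (-1)^n, the sign in (F2). As an involution compatible with composition
  and \<Sigma>, it lets the later arguments run without a case split on the parity of n.\<close>

definition signed :: "'b \<Rightarrow> 'b" where
  "signed f = (if even n then f else Neg T f)"

lemma signed_closed: "f \<in> Hom T X Y \<Longrightarrow> signed f \<in> Hom T X Y"
  by (simp add: signed_def Neg_closed)

lemma signed_signed: "f \<in> Hom T X Y \<Longrightarrow> signed (signed f) = f"
  by (simp add: signed_def Neg_Neg)

lemma SusA_signed: "f \<in> Hom T X Y \<Longrightarrow> SusA T (signed f) = signed (SusA T f)"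
  by (simp add: signed_def SusA_Neg)

lemma signed_Comp: "f \<in> Hom T X Y \<Longrightarrow> g \<in> Hom T Y Z \<Longrightarrow> signed g \<cdot> f = signed (g \<cdot> f)"
  by (simp add: signed_def Neg_Comp)

lemma Comp_signed: "f \<in> Hom T X Y \<Longrightarrow> g \<in> Hom T Y Z \<Longrightarrow> g \<cdot> signed f = signed (g \<cdot> f)"
  by (simp add: signed_def Comp_Neg)

lemma left_rotation_signed: "left_rotation T n \<alpha> = tl \<alpha> @ [signed (SusA T (hd \<alpha>))]"
  by (simp add: left_rotation_def signed_def)

section \<open>Rotation of sequences and of their morphisms\<close>

lemma left_rotation_nth:
  assumes "length \<alpha> = n"
  shows "Suc i < n \<Longrightarrow> left_rotation T n \<alpha> ! i = \<alpha> ! Suc i"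
    and "left_rotation T n \<alpha> ! (n - 1) = signed (SusA T (\<alpha> ! 0))"
proof -
  have "length (tl \<alpha>) = n - 1" "hd \<alpha> = \<alpha> ! 0"
    using assms n_ge_3 by (auto intro: hd_conv_nth)
  then show "Suc i < n \<Longrightarrow> left_rotation T n \<alpha> ! i = \<alpha> ! Suc i"
    and "left_rotation T n \<alpha> ! (n - 1) = signed (SusA T (\<alpha> ! 0))"
    by (auto simp: left_rotation_signed nth_append nth_tl)
qed

lemma is_seq_Hom:
  assumes "is_seq T n \<alpha>" "i < n"
  shows "\<alpha> ! i \<in> Hom T (Dom T (\<alpha> ! i)) (Dom T (wrap T \<alpha> ! Suc i))"
  using assms by (auto simp: is_seq_def Hom_def)

lemma is_seq_hd_last:
  assumes "is_seq T n \<alpha>"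
  shows "hd \<alpha> = \<alpha> ! 0" "last \<alpha> = \<alpha> ! (n - 1)"
    and "Dom T (hd \<alpha>) \<in> Obj T"
    and "last \<alpha> \<in> Hom T (Dom T (last \<alpha>)) (SusO T (Dom T (hd \<alpha>)))"
proof -
  have l: "length \<alpha> = n" "\<alpha> \<noteq> []"
    using assms n_ge_3 by (auto simp: is_seq_def)
  then show *: "hd \<alpha> = \<alpha> ! 0" "last \<alpha> = \<alpha> ! (n - 1)"
    by (auto simp: hd_conv_nth last_conv_nth)
  have a: "\<alpha> ! 0 \<in> Arr T"
    using assms l n_ge_3 by (auto simp: is_seq_def)
  then show "Dom T (hd \<alpha>) \<in> Obj T"
    by (simp add: * Dom_closed)
  \<comment> \<open>Position n of the wrapped list holds \<Sigma> \<alpha>_1, so the codomain of the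
    last map is the domain of that arrow, \<Sigma> A_1.\<close>
  have "wrap T \<alpha> ! Suc (n - 1) = SusA T (hd \<alpha>)"
    using wrap_nth_length[of T \<alpha>] l n_ge_3 by simp
  then show "last \<alpha> \<in> Hom T (Dom T (last \<alpha>)) (SusO T (Dom T (hd \<alpha>)))"
    using is_seq_Hom[OF assms, of "n - 1"] * n_ge_3 Dom_Cod_SusA[OF a] by simp
qed

text \<open>Desuspend f to f' : X' -> Y, complete the signed f' to an n-angle by (F1) and rotate
  once. The sign is inserted beforehand so that it cancels against the one produced by the
  rotation.\<close>

lemma ex_angle_last:
  assumes "f \<in> Hom T X (SusO T Y)" "Y \<in> Obj T"
  obtains \<alpha> where "\<alpha> \<in> Angles T" "last \<alpha> = f" "Dom T (hd \<alpha>) = Y"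
proof -
  obtain f' where f': "f' \<in> Arr T" "SusA T f' = f"
    using SusA_surj assms by (auto simp: Hom_def)
  define X' where "X' = Dom T f'"
  have "SusO T (Cod T f') = SusO T Y"
    using Dom_Cod_SusA[OF f'(1)] f'(2) assms by (auto simp: Hom_def)
  then have h: "f' \<in> Hom T X' Y"
    using SusO_inj assms(2) f' Cod_closed unfolding X'_def Hom_def by blast
  obtain \<beta> where \<beta>: "\<beta> \<in> Angles T" "hd \<beta> = signed f'"
    using F1_first signed_closed[OF h] by (auto simp: Hom_def)
  have s: "is_seq T n \<beta>"
    using Angles_seq \<beta> by blast
  then have l: "length \<beta> = n" by (simp add: is_seq_def)
  show ?thesis
  proof
    show "left_rotation T n \<beta> \<in> Angles T"
      using F2[OF s] \<beta> by simp
    show "last (left_rotation T n \<beta>) = f"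
      using \<beta> h f' by (simp add: left_rotation_signed SusA_signed[OF h] signed_signed[OF SusA_Hom[OF h], simplified f'(2)])
    have "hd (left_rotation T n \<beta>) = \<beta> ! 1"
      using left_rotation_nth(1)[of \<beta> 0] l n_ge_3
      by (simp add: hd_conv_nth left_rotation_signed)
    then show "Dom T (hd (left_rotation T n \<beta>)) = Y"
      using s n_ge_3 l wrap_nth_less[of 1 \<beta> T] signed_closed[OF h] \<beta> is_seq_hd_last(1)[OF s]
      by (auto simp: is_seq_def Hom_def dest!: spec[of _ 0])
  qed
qed

text \<open>(F2) is an equivalence, but using it backwards takes a sequence whose left rotation is
  the given one. It is built by dropping the last map and putting its desuspension, with sign, in
  front.\<close>

lemma ex_right_rotation:
  assumes "\<alpha> \<in> Angles T"
  obtains \<alpha>' where "\<alpha>' \<in> Angles T" "left_rotation T n \<alpha>' = \<alpha>"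
proof -
  have s: "is_seq T n \<alpha>"
    using Angles_seq assms by blast
  then have l: "length \<alpha> = n" "\<alpha> \<noteq> []" using n_ge_3 by (auto simp: is_seq_def)
  note la = is_seq_hd_last[OF s]
  obtain f where f: "f \<in> Arr T" "SusA T f = last \<alpha>"
    using SusA_surj la(4) by (auto simp: Hom_def)
  have cod: "Cod T f = Dom T (hd \<alpha>)"
    using Dom_Cod_SusA[OF f(1)] f la SusO_inj Cod_closed by (auto simp: Hom_def)
  note h = HomI[OF f(1)]
  define \<alpha>' where "\<alpha>' = signed f # butlast \<alpha>"
  have rot: "left_rotation T n \<alpha>' = \<alpha>"
    using l f(2) signed_signed[OF SusA_Hom[OF h]]
    by (simp add: left_rotation_signed \<alpha>'_def SusA_signed[OF h])
  have "is_seq T n \<alpha>'"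
    unfolding is_seq_def
  proof (intro conjI allI impI)
    show len: "length \<alpha>' = n" using l n_ge_3 by (simp add: \<alpha>'_def)
    show "set \<alpha>' \<subseteq> Arr T"
      using s signed_closed[OF h] by (auto simp: \<alpha>'_def is_seq_def Hom_def dest!: in_set_butlastD)
    fix i assume i: "i < n"
    \<comment> \<open>Three kinds of joints: from the new head to the old first map, between two old
      maps, and from the last surviving old map to the suspended new head.\<close>
    consider "i = 0" | j where "i = Suc j" "Suc i < n" | "Suc i = n" "i = Suc (n - 2)"
      using i n_ge_3 by (cases i) force+
    then show "Cod T (\<alpha>' ! i) = Dom T (wrap T \<alpha>' ! Suc i)"
    proof cases
      case 1
      then show ?thesis
        using wrap_nth_less[of 1 \<alpha>' T] len n_ge_3 l signed_closed[OF h] cod la(1)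
        by (simp add: \<alpha>'_def Hom_def nth_butlast)
    next
      case 2
      then show ?thesis
        using wrap_nth_less[of "Suc i" \<alpha>' T] wrap_nth_less[of "Suc j" \<alpha> T] len l s
        by (simp add: \<alpha>'_def nth_butlast is_seq_def)
    next
      case 3
      have "Cod T (\<alpha> ! (n - 2)) = Dom T (last \<alpha>)"
        using s wrap_nth_less[of "n - 1" \<alpha> T] l n_ge_3 la(2) Suc_diff_Suc[of 1 n]
        by (simp add: is_seq_def numeral_2_eq_2)
      also have "\<dots> = Dom T (SusA T (signed f))"
        using SusA_signed[OF h] signed_closed[OF SusA_Hom[OF h]] f SusA_Hom[OF h]
        by (simp add: Hom_def)
      finally show ?thesis
        using 3 wrap_nth_length[of T \<alpha>'] len l n_ge_3 by (simp add: \<alpha>'_def nth_butlast)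
    qed
  qed
  then show ?thesis
    using F2 rot assms that by metis
qed

text \<open>\<open>tl (wrap T \<phi>)\<close> is (\<phi>_2, ..., \<phi>_n, \<Sigma> \<phi>_1). All
  squares but the last are squares of \<phi> shifted by one; the last is \<Sigma> of the first
  square, with the same sign on both horizontal maps.\<close>

lemma is_seq_mor_left_rotation:
  assumes \<alpha>: "is_seq T n \<alpha>" and \<beta>: "is_seq T n \<beta>" and \<phi>: "is_seq_mor T n \<alpha> \<beta> \<phi>"
  shows "is_seq_mor T n (left_rotation T n \<alpha>) (left_rotation T n \<beta>) (tl (wrap T \<phi>))"
    (is "is_seq_mor T n ?\<alpha> ?\<beta> ?\<phi>")
  unfolding is_seq_mor_def
proof (intro conjI allI impI)
  have l: "length \<alpha> = n" "length \<beta> = n" "length \<phi> = n" "\<phi> \<noteq> []"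
    using assms n_ge_3 by (auto simp: is_seq_def is_seq_mor_def)
  then show len: "length ?\<phi> = n" using n_ge_3 by (simp add: wrap_def)
  have nth: "?\<phi> ! i = wrap T \<phi> ! Suc i" if "i < n" for i
    using l(4) by (cases \<phi>) (simp_all add: wrap_def)
  have \<phi>_nth: "\<phi> ! i \<in> Hom T (Dom T (\<alpha> ! i)) (Dom T (\<beta> ! i))"
    "wrap T \<phi> ! Suc i \<cdot> \<alpha> ! i = \<beta> ! i \<cdot> \<phi> ! i" if "i < n" for i
    using \<phi> that by (auto simp: is_seq_mor_def)
  note \<phi>0 = \<phi>_nth(1)[of 0] and a0 = is_seq_Hom[OF \<alpha>, of 0] and b0 = is_seq_Hom[OF \<beta>, of 0]
  note Sa0 = SusA_Hom[OF a0] and Sb0 = SusA_Hom[OF b0]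
  have w1: "wrap T \<alpha> ! Suc 0 = \<alpha> ! 1" "wrap T \<beta> ! Suc 0 = \<beta> ! 1" "wrap T \<phi> ! Suc 0 = \<phi> ! 1"
    using l n_ge_3 by (auto simp: wrap_nth_less)
  fix i assume i: "i < n"
  consider "Suc i < n" | "i = n - 1" "Suc i = n"
    using i n_ge_3 by (cases "Suc i = n") auto
  then have "?\<phi> ! i \<in> Hom T (Dom T (?\<alpha> ! i)) (Dom T (?\<beta> ! i)) \<and>
    wrap T ?\<phi> ! Suc i \<cdot> ?\<alpha> ! i = ?\<beta> ! i \<cdot> ?\<phi> ! i"
  proof cases
    case 1
    then show ?thesis
      using \<phi>_nth[of "Suc i"] nth[OF i] nth[OF 1] l left_rotation_nth(1)[OF l(1) 1]
        left_rotation_nth(1)[OF l(2) 1] wrap_nth_less[of "Suc i" ?\<phi> T, unfolded len, OF 1]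
      by (simp add: wrap_nth_less)
  next
    case 2
    have last: "?\<phi> ! i = SusA T (\<phi> ! 0)"
      using nth[OF i] 2 wrap_nth_length[of T \<phi>] l by (simp add: hd_conv_nth)
    have "0 < length ?\<phi>"
      using len n_ge_3 by linarith
    then have "wrap T ?\<phi> ! Suc i = SusA T (?\<phi> ! 0)"
      using wrap_nth_length[of T ?\<phi>, unfolded len] 2(2) by (metis hd_conv_nth length_greater_0_conv)
    also have "\<dots> = SusA T (\<phi> ! 1)"
      using nth[of 0] w1 n_ge_3 by simp
    finally have first: "wrap T ?\<phi> ! Suc i = SusA T (\<phi> ! 1)" .
    have r: "?\<alpha> ! i = signed (SusA T (\<alpha> ! 0))" "?\<beta> ! i = signed (SusA T (\<beta> ! 0))"
      using 2 left_rotation_nth(2) l by auto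
    have n0: "0 < n" "1 < n" using n_ge_3 by auto
    have \<phi>1: "\<phi> ! 1 \<in> Hom T (Dom T (wrap T \<alpha> ! Suc 0)) (Dom T (wrap T \<beta> ! Suc 0))"
      using \<phi>_nth(1)[OF n0(2)] w1 by simp
    have "SusA T (\<phi> ! 1) \<cdot> SusA T (\<alpha> ! 0) = SusA T (\<beta> ! 0) \<cdot> SusA T (\<phi> ! 0)"
      using \<phi>_nth(2)[OF n0(1)] SusA_Comp[OF a0[OF n0(1)] \<phi>1] SusA_Comp[OF \<phi>0[OF n0(1)] b0[OF n0(1)]] w1
      by simp
    then have "SusA T (\<phi> ! 1) \<cdot> ?\<alpha> ! i = ?\<beta> ! i \<cdot> SusA T (\<phi> ! 0)"
      using r Comp_signed[OF Sa0[OF n0(1)] SusA_Hom[OF \<phi>1]]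
        signed_Comp[OF SusA_Hom[OF \<phi>0[OF n0(1)]] Sb0[OF n0(1)]] by simp
    moreover have "SusA T (\<phi> ! 0) \<in> Hom T (Dom T (?\<alpha> ! i)) (Dom T (?\<beta> ! i))"
      using SusA_Hom[OF \<phi>0[OF n0(1)]] HomD[OF signed_closed[OF Sa0[OF n0(1)]]]
        HomD[OF signed_closed[OF Sb0[OF n0(1)]]] r by simp
    ultimately show ?thesis
      using last first by simp
  qed
  then show "?\<phi> ! i \<in> Hom T (Dom T (?\<alpha> ! i)) (Dom T (?\<beta> ! i))"
    and "wrap T ?\<phi> ! Suc i \<cdot> ?\<alpha> ! i = ?\<beta> ! i \<cdot> ?\<phi> ! i" by blast+
qed

text \<open>(F3) extends squares on first maps. Rotating both n-angles back turns their last maps,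
  up to sign and \<Sigma>, into first maps; (F3) applies there to g and the desuspension f' of f,
  and the resulting morphism is rotated forward.\<close>

lemma ex_seq_mor_last:
  assumes \<alpha>: "\<alpha> \<in> Angles T" and \<beta>: "\<beta> \<in> Angles T"
    and g: "g \<in> Hom T (Dom T (hd \<alpha>)) (Dom T (hd \<beta>))"
    and f: "f \<in> Hom T (Dom T (last \<alpha>)) (Dom T (last \<beta>))"
    and comm: "SusA T g \<cdot> last \<alpha> = last \<beta> \<cdot> f"
  obtains \<phi> where "is_seq_mor T n \<alpha> \<beta> \<phi>" "hd \<phi> = g" "last \<phi> = f"
proof -
  obtain \<alpha>' \<beta>' where \<alpha>': "\<alpha>' \<in> Angles T" "left_rotation T n \<alpha>' = \<alpha>"
    and \<beta>': "\<beta>' \<in> Angles T" "left_rotation T n \<beta>' = \<beta>"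
    using ex_right_rotation \<alpha> \<beta> by metis
  have unrotate: "hd \<gamma> = \<gamma>' ! 1 \<and> \<gamma>' ! 0 \<in> Hom T (Dom T (\<gamma>' ! 0)) (Dom T (\<gamma>' ! 1)) \<and>
      last \<gamma> = signed (SusA T (\<gamma>' ! 0)) \<and> Dom T (last \<gamma>) = SusO T (Dom T (\<gamma>' ! 0))"
    if "\<gamma>' \<in> Angles T" "left_rotation T n \<gamma>' = \<gamma>" for \<gamma> \<gamma>'
  proof -
    have s: "is_seq T n \<gamma>'" "is_seq T n \<gamma>"
      using that Angles_seq F2 by auto
    then have l: "length \<gamma>' = n" "length \<gamma> = n" by (auto simp: is_seq_def)
    have h: "\<gamma>' ! 0 \<in> Hom T (Dom T (\<gamma>' ! 0)) (Dom T (\<gamma>' ! 1))"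
      using is_seq_Hom[OF s(1), of 0] n_ge_3 l by (simp add: wrap_nth_less)
    show ?thesis
      using that(2) left_rotation_nth(1)[OF l(1), of 0] left_rotation_nth(2)[OF l(1)]
        is_seq_hd_last[OF s(2)] n_ge_3 h HomD[OF signed_closed[OF SusA_Hom[OF h]]]
      by auto
  qed
  note u\<alpha> = unrotate[OF \<alpha>'] and u\<beta> = unrotate[OF \<beta>']
  obtain f' where f': "f' \<in> Arr T" "SusA T f' = f"
    using SusA_surj f by (auto simp: Hom_def)
  have f'_Hom: "f' \<in> Hom T (Dom T (\<alpha>' ! 0)) (Dom T (\<beta>' ! 0))"
    using SusA_Hom_iff[OF f'(1)] f f' u\<alpha> u\<beta> Hom_Obj by metis
  have g': "g \<in> Hom T (Dom T (\<alpha>' ! 1)) (Dom T (\<beta>' ! 1))"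
    using g u\<alpha> u\<beta> by simp
  have a: "\<alpha>' ! 0 \<in> Hom T (Dom T (\<alpha>' ! 0)) (Dom T (\<alpha>' ! 1))"
    and b: "\<beta>' ! 0 \<in> Hom T (Dom T (\<beta>' ! 0)) (Dom T (\<beta>' ! 1))"
    using u\<alpha> u\<beta> by auto
  \<comment> \<open>The hypothesis is the desired first square after applying \<Sigma> and the sign;
    both are injective and can be stripped off.\<close>
  have "signed (SusA T (g \<cdot> \<alpha>' ! 0)) = signed (SusA T (\<beta>' ! 0 \<cdot> f'))"
    using comm u\<alpha> u\<beta> f' SusA_Comp[OF a g'] SusA_Comp[OF f'_Hom b]
      Comp_signed[OF SusA_Hom[OF a] SusA_Hom[OF g']]
      signed_Comp[OF SusA_Hom[OF f'_Hom] SusA_Hom[OF b]] by simp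
  then have "SusA T (g \<cdot> \<alpha>' ! 0) = SusA T (\<beta>' ! 0 \<cdot> f')"
    using signed_signed[OF SusA_Hom[OF Comp_closed[OF a g']]]
      signed_signed[OF SusA_Hom[OF Comp_closed[OF f'_Hom b]]] by metis
  then have "g \<cdot> \<alpha>' ! 0 = \<beta>' ! 0 \<cdot> f'"
    using SusA_inj Comp_closed[OF a g'] Comp_closed[OF f'_Hom b] by (auto simp: Hom_def)
  then obtain \<phi> where \<phi>: "is_seq_mor T n \<alpha>' \<beta>' \<phi>" "\<phi> ! 0 = f'" "\<phi> ! 1 = g"
    using F3[OF \<alpha>'(1) \<beta>'(1) f'_Hom g'] by blast
  have l: "length \<phi> = n" "\<phi> \<noteq> []" "tl \<phi> \<noteq> []"
    using \<phi>(1) n_ge_3 by (auto simp: is_seq_mor_def tl_Nil)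
  show ?thesis
  proof
    show "is_seq_mor T n \<alpha> \<beta> (tl (wrap T \<phi>))"
      using is_seq_mor_left_rotation[OF Angles_seq[OF \<alpha>'(1)] Angles_seq[OF \<beta>'(1)] \<phi>(1)] \<alpha>' \<beta>'
      by simp
    show "hd (tl (wrap T \<phi>)) = g"
      using l \<phi>(3) n_ge_3 hd_conv_nth[of "tl \<phi>"] by (simp add: wrap_def nth_tl)
    show "last (tl (wrap T \<phi>)) = f"
      using l \<phi>(2) f'(2) by (simp add: wrap_def hd_conv_nth)
  qed
qed


section \<open>Biproducts and direct sums of sequences\<close>

lemma SusA_biproduct:
  assumes "is_biproduct T X Y P \<iota>1 \<iota>2 \<pi>1 \<pi>2"
  shows "is_biproduct T (SusO T X) (SusO T Y) (SusO T P) (SusA T \<iota>1) (SusA T \<iota>2) (SusA T \<pi>1) (SusA T \<pi>2)"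
proof -
  note b = assms[unfolded is_biproduct_def]
  have h: "\<iota>1 \<in> Hom T X P" "\<iota>2 \<in> Hom T Y P" "\<pi>1 \<in> Hom T P X" "\<pi>2 \<in> Hom T P Y"
    using b by auto
  have o: "X \<in> Obj T" "Y \<in> Obj T" "P \<in> Obj T"
    using h Hom_Obj by blast+
  have c: "\<iota>1 \<cdot> \<pi>1 \<in> Hom T P P" "\<iota>2 \<cdot> \<pi>2 \<in> Hom T P P"
    using h Comp_closed by blast+
  show ?thesis
    unfolding is_biproduct_def
    using b o SusO_closed SusA_Hom h SusA_Id SusA_Zero SusA_Add[OF c]
      SusA_Comp[OF h(1) h(3)] SusA_Comp[OF h(2) h(4)] SusA_Comp[OF h(1) h(4)]
      SusA_Comp[OF h(2) h(3)] SusA_Comp[OF h(3) h(1)] SusA_Comp[OF h(4) h(2)]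
    by (intro conjI) metis+
qed

text \<open>A row (h, k) after a column (f, g): the mixed terms die on the zero composites of the
  biproduct. Read from right to left, it writes a sum of two composites as one composite through P,
  the device behind the additive closure of phantoms, of \<open>PB\<close> and of
  \<open>PO\<close>.\<close>

lemma biproduct_Comp:
  assumes "is_biproduct T X Y P \<iota>1 \<iota>2 \<pi>1 \<pi>2"
    and f: "f \<in> Hom T W X" and g: "g \<in> Hom T W Y" and h: "h \<in> Hom T X Z" and k: "k \<in> Hom T Y Z"
  shows "((h \<cdot> \<pi>1) \<boxplus> (k \<cdot> \<pi>2)) \<cdot> ((\<iota>1 \<cdot> f) \<boxplus> (\<iota>2 \<cdot> g)) = (h \<cdot> f) \<boxplus> (k \<cdot> g)"
proof -
  note b = assms(1)[unfolded is_biproduct_def]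
  have m: "\<iota>1 \<in> Hom T X P" "\<iota>2 \<in> Hom T Y P" "\<pi>1 \<in> Hom T P X" "\<pi>2 \<in> Hom T P Y"
    using b by auto
  have o: "X \<in> Obj T" "Y \<in> Obj T"
    using m Hom_Obj by blast+
  have hp: "h \<cdot> \<pi>1 \<in> Hom T P Z" "k \<cdot> \<pi>2 \<in> Hom T P Z"
    and fi: "\<iota>1 \<cdot> f \<in> Hom T W P" "\<iota>2 \<cdot> g \<in> Hom T W P"
    using m f g h k Comp_closed by blast+
  have cancel: "\<pi>1 \<cdot> \<iota>1 \<cdot> f = f" "\<pi>2 \<cdot> \<iota>2 \<cdot> g = g"
    "\<pi>1 \<cdot> \<iota>2 \<cdot> g = Zero T W X" "\<pi>2 \<cdot> \<iota>1 \<cdot> f = Zero T W Y"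
    using b o Comp_assoc[OF f m(1) m(3)] Comp_assoc[OF g m(2) m(4)] Comp_assoc[OF g m(2) m(3)]
      Comp_assoc[OF f m(1) m(4)] Id_Comp[OF f] Id_Comp[OF g] Zero_Comp[OF f] Zero_Comp[OF g]
    by metis+
  have "(h \<cdot> \<pi>1) \<cdot> ((\<iota>1 \<cdot> f) \<boxplus> (\<iota>2 \<cdot> g)) = h \<cdot> f"
    using Comp_assoc[OF Add_closed[OF fi] m(3) h] Comp_Add[OF fi m(3)] cancel Add_Zero[OF f] by simp
  moreover have "(k \<cdot> \<pi>2) \<cdot> ((\<iota>1 \<cdot> f) \<boxplus> (\<iota>2 \<cdot> g)) = k \<cdot> g"
    using Comp_assoc[OF Add_closed[OF fi] m(4) k] Comp_Add[OF fi m(4)] cancel Zero_Add[OF g] by simp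
  ultimately show ?thesis
    using Add_Comp[OF Add_closed[OF fi] hp] by simp
qed

text \<open>\<open>is_direct_sum\<close> leaves the biproducts open, so existence takes a choice of
  one at each position and a check that the matrices fit together, including at the suspended last
  term.\<close>

lemma ex_direct_sum:
  assumes \<alpha>: "is_seq T n \<alpha>" and \<beta>: "is_seq T n \<beta>"
  obtains \<gamma> where "is_direct_sum T n \<alpha> \<beta> \<gamma>"
proof -
  let ?X = "\<lambda>i. Dom T (\<alpha> ! i)" and ?Y = "\<lambda>i. Dom T (\<beta> ! i)"
  \<comment> \<open>The bound on i sits inside the existentials so that choice yields functions
    defined at every index.\<close>
  have "\<exists>P i1 i2 p1 p2. i < n \<longrightarrow> is_biproduct T (?X i) (?Y i) P i1 i2 p1 p2" for i
  proof (cases "i < n")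
    case True
    then have "?X i \<in> Obj T" "?Y i \<in> Obj T"
      using is_seq_Hom[OF \<alpha>] is_seq_Hom[OF \<beta>] Hom_Obj by blast+
    then show ?thesis
      using ex_biproduct by blast
  qed auto
  then obtain P i1 i2 p1 p2 where
    b: "\<And>i. i < n \<Longrightarrow> is_biproduct T (?X i) (?Y i) (P i) (i1 i) (i2 i) (p1 i) (p2 i)"
    by metis
  define J1 where "J1 = map i1 [0..<n]"
  define J2 where "J2 = map i2 [0..<n]"
  have l: "length \<alpha> = n" "length \<beta> = n" "length J1 = n" "length J2 = n" "0 < n"
    using \<alpha> \<beta> n_ge_3 by (auto simp: is_seq_def J1_def J2_def)
  \<comment> \<open>Target of the i-th map: the next chosen biproduct, or the suspension of the
    first one at i = n - 1.\<close>
  define Q where "Q i = (if Suc i < n then P (Suc i) else SusO T (P 0))" for i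
  have inj: "wrap T J1 ! Suc i \<in> Hom T (Cod T (\<alpha> ! i)) (Q i)"
    "wrap T J2 ! Suc i \<in> Hom T (Cod T (\<beta> ! i)) (Q i)" if i: "i < n" for i
  proof -
    have cod: "Cod T (\<alpha> ! i) = Dom T (wrap T \<alpha> ! Suc i)" "Cod T (\<beta> ! i) = Dom T (wrap T \<beta> ! Suc i)"
      using \<alpha> \<beta> i by (auto simp: is_seq_def)
    show "wrap T J1 ! Suc i \<in> Hom T (Cod T (\<alpha> ! i)) (Q i)"
      "wrap T J2 ! Suc i \<in> Hom T (Cod T (\<beta> ! i)) (Q i)"
    proof (atomize (full), cases "Suc i < n")
      case True
      then show "wrap T J1 ! Suc i \<in> Hom T (Cod T (\<alpha> ! i)) (Q i) \<and>
        wrap T J2 ! Suc i \<in> Hom T (Cod T (\<beta> ! i)) (Q i)"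
        using b[OF True] l cod by (simp add: wrap_nth_less Q_def J1_def J2_def is_biproduct_def)
    next
      case False
      then have e: "Suc i = n" using i by simp
      have "\<alpha> ! 0 \<in> Arr T" "\<beta> ! 0 \<in> Arr T"
        using \<alpha> \<beta> l by (auto simp: is_seq_def)
      then have "Cod T (\<alpha> ! i) = SusO T (?X 0)" "Cod T (\<beta> ! i) = SusO T (?Y 0)"
        using cod e l wrap_nth_length[of T \<alpha>] wrap_nth_length[of T \<beta>] Dom_Cod_SusA
          is_seq_hd_last(1)[OF \<alpha>] is_seq_hd_last(1)[OF \<beta>] by auto
      moreover have "wrap T J1 ! Suc i = SusA T (i1 0)" "wrap T J2 ! Suc i = SusA T (i2 0)"
        using e l wrap_nth_length[of T J1] wrap_nth_length[of T J2]
        by (auto simp: J1_def J2_def hd_map)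
      ultimately show "wrap T J1 ! Suc i \<in> Hom T (Cod T (\<alpha> ! i)) (Q i) \<and>
        wrap T J2 ! Suc i \<in> Hom T (Cod T (\<beta> ! i)) (Q i)"
        using b[OF l(5)] False by (simp add: Q_def is_biproduct_def SusA_Hom)
    qed
  qed
  define M where "M i = matrix_mor T (wrap T J1 ! Suc i) (wrap T J2 ! Suc i) (p1 i) (p2 i)
    (\<alpha> ! i) (Zero T (?Y i) (Cod T (\<alpha> ! i))) (Zero T (?X i) (Cod T (\<beta> ! i))) (\<beta> ! i)" for i
  define \<gamma> where "\<gamma> = map M [0..<n]"
  have M: "M i \<in> Hom T (P i) (Q i)" if i: "i < n" for i
  proof -
    have "\<alpha> ! i \<in> Arr T" "\<beta> ! i \<in> Arr T"
      using \<alpha> \<beta> i by (auto simp: is_seq_def)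
    then show ?thesis
      unfolding M_def using b[OF i] inj[OF i] unfolding is_biproduct_def
      by (intro matrix_mor_closed[where X = "?X i" and Y = "?Y i"])
        (auto intro: HomI Zero_closed Dom_closed Cod_closed)
  qed
  have \<gamma>_nth: "\<gamma> ! i = M i" if "i < n" for i
    using that by (simp add: \<gamma>_def)
  have len: "length \<gamma> = n" by (simp add: \<gamma>_def)
  have "is_seq T n \<gamma>"
    unfolding is_seq_def
  proof (intro conjI allI impI)
    show "length \<gamma> = n" by (fact len)
    show "set \<gamma> \<subseteq> Arr T"
      using M by (auto simp: \<gamma>_def Hom_def)
    fix i assume i: "i < n"
    show "Cod T (\<gamma> ! i) = Dom T (wrap T \<gamma> ! Suc i)"
    proof (cases "Suc i < n")
      case True
      then show ?thesis
        using M[OF i] M[OF True] \<gamma>_nth i len by (simp add: wrap_nth_less Q_def Hom_def)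
    next
      case False
      then have "Suc i = length \<gamma>"
        using i len by simp
      then have "wrap T \<gamma> ! Suc i = SusA T (M 0)"
        using wrap_nth_length[of T \<gamma>] l(5) by (simp add: \<gamma>_def hd_map)
      then show ?thesis
        using M[OF i] SusA_Hom[OF M[OF l(5)]] \<gamma>_nth[OF i] False by (simp add: Q_def Hom_def)
    qed
  qed
  moreover have "\<forall>i<n. is_biproduct T (?X i) (?Y i) (Dom T (\<gamma> ! i)) (J1 ! i) (J2 ! i)
      (map p1 [0..<n] ! i) (map p2 [0..<n] ! i) \<and>
    \<gamma> ! i = matrix_mor T (wrap T J1 ! Suc i) (wrap T J2 ! Suc i) (map p1 [0..<n] ! i)
      (map p2 [0..<n] ! i) (\<alpha> ! i) (Zero T (?Y i) (Cod T (\<alpha> ! i)))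
      (Zero T (?X i) (Cod T (\<beta> ! i))) (\<beta> ! i)"
    using b M \<gamma>_nth by (simp add: J1_def J2_def Hom_def M_def)
  moreover have "length (map p1 [0..<n]) = n" "length (map p2 [0..<n]) = n"
    by simp_all
  ultimately have "is_direct_sum T n \<alpha> \<beta> \<gamma>"
    unfolding is_direct_sum_def is_matrix_seq_def using \<alpha> \<beta> l(3,4) by blast
  then show ?thesis by (fact that)
qed

text \<open>Later arguments inspect a direct sum only through its last map and the biproducts at its
  two ends: \<kappa> and \<rho> belong to the first objects, \<iota> and \<pi> to the n-th
  ones.\<close>

lemma direct_sum_last:
  assumes "is_direct_sum T n \<alpha> \<beta> \<gamma>"
  obtains \<iota>1 \<iota>2 \<pi>1 \<pi>2 \<kappa>1 \<kappa>2 \<rho>1 \<rho>2 where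
    "is_biproduct T (Dom T (last \<alpha>)) (Dom T (last \<beta>)) (Dom T (last \<gamma>)) \<iota>1 \<iota>2 \<pi>1 \<pi>2"
    "is_biproduct T (Dom T (hd \<alpha>)) (Dom T (hd \<beta>)) (Dom T (hd \<gamma>)) \<kappa>1 \<kappa>2 \<rho>1 \<rho>2"
    "last \<gamma> = (SusA T \<kappa>1 \<cdot> last \<alpha> \<cdot> \<pi>1) \<boxplus> (SusA T \<kappa>2 \<cdot> last \<beta> \<cdot> \<pi>2)"
proof -
  have s: "is_seq T n \<alpha>" "is_seq T n \<beta>" "is_seq T n \<gamma>"
    using assms by (auto simp: is_direct_sum_def is_matrix_seq_def)
  note hl = is_seq_hd_last(1,2)[OF s(1)] is_seq_hd_last(1,2)[OF s(2)] is_seq_hd_last(1,2)[OF s(3)]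
  obtain \<iota>1 \<iota>2 \<pi>1 \<pi>2 where l: "length \<iota>1 = n" "length \<iota>2 = n" and b:
    "\<And>i. i < n \<Longrightarrow> is_biproduct T (Dom T (\<alpha> ! i)) (Dom T (\<beta> ! i)) (Dom T (\<gamma> ! i))
      (\<iota>1 ! i) (\<iota>2 ! i) (\<pi>1 ! i) (\<pi>2 ! i)"
    and m: "\<And>i. i < n \<Longrightarrow> \<gamma> ! i = matrix_mor T (wrap T \<iota>1 ! Suc i) (wrap T \<iota>2 ! Suc i)
      (\<pi>1 ! i) (\<pi>2 ! i) (\<alpha> ! i) (Zero T (Dom T (\<beta> ! i)) (Cod T (\<alpha> ! i)))
      (Zero T (Dom T (\<alpha> ! i)) (Cod T (\<beta> ! i))) (\<beta> ! i)"
    using assms unfolding is_direct_sum_def is_matrix_seq_def by blast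
  have n: "0 < n" "n - 1 < n" "Suc (n - 1) = n" using n_ge_3 by auto
  have w: "wrap T \<iota>1 ! Suc (n - 1) = SusA T (\<iota>1 ! 0)" "wrap T \<iota>2 ! Suc (n - 1) = SusA T (\<iota>2 ! 0)"
    using n(1,3) wrap_nth_length[of T \<iota>1] wrap_nth_length[of T \<iota>2] l
    by (metis hd_conv_nth length_greater_0_conv)+
  note bn = b[OF n(2), unfolded is_biproduct_def] and b0 = b[OF n(1), unfolded is_biproduct_def]
  have a: "\<alpha> ! (n - 1) \<in> Hom T (Dom T (\<alpha> ! (n - 1))) (SusO T (Dom T (\<alpha> ! 0)))"
    "\<beta> ! (n - 1) \<in> Hom T (Dom T (\<beta> ! (n - 1))) (SusO T (Dom T (\<beta> ! 0)))"
    using is_seq_hd_last(4)[OF s(1)] is_seq_hd_last(4)[OF s(2)] hl by auto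
  have \<iota>\<pi>: "\<pi>1 ! (n - 1) \<in> Hom T (Dom T (\<gamma> ! (n - 1))) (Dom T (\<alpha> ! (n - 1)))"
    "\<pi>2 ! (n - 1) \<in> Hom T (Dom T (\<gamma> ! (n - 1))) (Dom T (\<beta> ! (n - 1)))"
    "\<iota>1 ! 0 \<in> Hom T (Dom T (\<alpha> ! 0)) (Dom T (\<gamma> ! 0))"
    "\<iota>2 ! 0 \<in> Hom T (Dom T (\<beta> ! 0)) (Dom T (\<gamma> ! 0))"
    using bn b0 by blast+
  have "last \<gamma> = (SusA T (\<iota>1 ! 0) \<cdot> last \<alpha> \<cdot> \<pi>1 ! (n - 1)) \<boxplus> (SusA T (\<iota>2 ! 0) \<cdot> last \<beta> \<cdot> \<pi>2 ! (n - 1))"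
    unfolding hl
    using m[OF n(2), unfolded w HomD[OF a(1), THEN conjunct2, THEN conjunct2]
        HomD[OF a(2), THEN conjunct2, THEN conjunct2]]
      matrix_mor_diagonal[OF \<iota>\<pi>(1,2) SusA_Hom[OF \<iota>\<pi>(3)] SusA_Hom[OF \<iota>\<pi>(4)] a] by (rule trans)
  then show ?thesis
    using b[OF n(1)] b[OF n(2)] that hl by simp
qed

end

section \<open>Phantoms of an almost exact structure\<close>

text \<open>Packaged as a locale so that it can be instantiated a second time with some F in
  \<open>Ex_str T n A E\<close> and the same \<open>A\<close>; every result on phantoms then serves
  both structures.\<close>

locale almost_exact_structure = n_angulated_category T n for T (structure) and n +
  fixes A E
  assumes ext_closed: "ext_closed_subcategory T n A"
    and almost_exact: "almost_n_exact T n A E"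
begin

lemma A_Obj: "X \<in> A \<Longrightarrow> X \<in> Obj T"
  using ext_closed by (auto simp: ext_closed_subcategory_def)

text \<open>Extension-closure supplies the middle objects, so it suffices to look at the two ends.
  This makes split n-angles between prescribed objects of \<open>A\<close> available.\<close>

lemma mem_angles_in:
  "\<alpha> \<in> Angles T \<Longrightarrow> Dom T (hd \<alpha>) \<in> A \<Longrightarrow> Dom T (last \<alpha>) \<in> A \<Longrightarrow> \<alpha> \<in> angles_in T n A"
  using ext_closed by (auto simp: ext_closed_subcategory_def angles_in_def)

lemmas almost_exact_conjuncts = almost_exact[unfolded almost_n_exact_def]

lemma E_subset: "E \<subseteq> angles_in T n A"
  by (rule almost_exact_conjuncts[THEN conjunct1])

lemma mem_E_facts:
  assumes "\<alpha> \<in> E"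
  shows "\<alpha> \<in> Angles T" "Dom T (hd \<alpha>) \<in> A" "Dom T (last \<alpha>) \<in> A"
    and "last \<alpha> \<in> Hom T (Dom T (last \<alpha>)) (SusO T (Dom T (hd \<alpha>)))"
    and "last \<alpha> \<in> phantoms E"
proof -
  have *: "\<alpha> \<in> Angles T" "\<forall>i<n. Dom T (\<alpha> ! i) \<in> A"
    using assms E_subset by (auto simp: angles_in_def)
  note s = is_seq_hd_last[OF Angles_seq[OF *(1)]]
  show "\<alpha> \<in> Angles T" "Dom T (hd \<alpha>) \<in> A" "Dom T (last \<alpha>) \<in> A"
    "last \<alpha> \<in> Hom T (Dom T (last \<alpha>)) (SusO T (Dom T (hd \<alpha>)))" "last \<alpha> \<in> phantoms E"
    using * s(1,2,4) n_ge_3 imageI[OF assms, of last] by (auto simp: phantoms_def)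
qed

lemma E_direct_sum: "\<alpha> \<in> E \<Longrightarrow> \<beta> \<in> E \<Longrightarrow> is_direct_sum T n \<alpha> \<beta> \<gamma> \<Longrightarrow> \<gamma> \<in> E"
  using almost_exact_conjuncts[THEN conjunct2, THEN conjunct1] by blast

lemma E_split: "\<alpha> \<in> angles_in T n A \<Longrightarrow> is_split T \<alpha> \<Longrightarrow> \<alpha> \<in> E"
  using almost_exact_conjuncts[THEN conjunct2, THEN conjunct2, THEN conjunct1] by blast

section \<open>The axioms (N1)-(N3) in terms of phantoms\<close>

lemma phantomE:
  assumes "h \<in> phantoms E"
  obtains X Y where "X \<in> A" "Y \<in> A" "h \<in> Hom T X (SusO T Y)"
  using assms mem_E_facts(2,3,4) by (metis imageE phantoms_def)

text \<open>A phantom shows only the object \<Sigma> Y; injectivity of \<Sigma> on objects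
  identifies Y with the first object of an n-angle realising it.\<close>

lemma phantom_angleE:
  assumes "h \<in> phantoms E" "h \<in> Hom T X (SusO T Y)" "Y \<in> Obj T"
  obtains \<alpha> where "\<alpha> \<in> E" "last \<alpha> = h" "Dom T (hd \<alpha>) = Y" "Dom T (last \<alpha>) = X" "X \<in> A" "Y \<in> A"
proof -
  obtain \<alpha> where \<alpha>: "\<alpha> \<in> E" "last \<alpha> = h"
    using assms(1) by (auto simp: phantoms_def)
  note d = mem_E_facts[OF \<alpha>(1)]
  have "Dom T (last \<alpha>) = X" "SusO T (Dom T (hd \<alpha>)) = SusO T Y"
    using d(4) assms(2) \<alpha>(2) by (auto simp: Hom_def)
  then show ?thesis
    using that \<alpha> d SusO_inj A_Obj assms(3) by metis
qed

text \<open>(N2) asks for a morphism of n-angles. The square of last maps commutes by the very form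
  of the last map of \<beta>, so \<open>ex_seq_mor_last\<close> provides that morphism and the
  condition concerns the last map alone.\<close>

lemma pullback_in_E:
  assumes \<alpha>: "\<alpha> \<in> E" and f: "f \<in> Hom T B (Dom T (last \<alpha>))" "B \<in> A"
    and \<beta>: "\<beta> \<in> Angles T" "last \<beta> = last \<alpha> \<cdot> f" "Dom T (hd \<beta>) = Dom T (hd \<alpha>)"
  shows "\<beta> \<in> E"
proof -
  note d = mem_E_facts[OF \<alpha>]
  have Id: "Id T (Dom T (hd \<alpha>)) \<in> Hom T (Dom T (hd \<beta>)) (Dom T (hd \<alpha>))"
    using Id_closed A_Obj d(2) \<beta>(3) by simp
  have l: "last \<beta> \<in> Hom T B (SusO T (Dom T (hd \<alpha>)))"
    using Comp_closed[OF f(1) d(4)] \<beta>(2) by simp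
  then have "Dom T (last \<beta>) = B" "SusA T (Id T (Dom T (hd \<alpha>))) \<cdot> last \<beta> = last \<beta>"
    using Id_Comp[OF l] SusA_Id A_Obj d(2) by (auto simp: Hom_def)
  then obtain \<phi> where "is_seq_mor T n \<beta> \<alpha> \<phi>" "hd \<phi> = Id T (Dom T (hd \<alpha>))" "last \<phi> = f"
    using ex_seq_mor_last[OF \<beta>(1) d(1) Id, of f] f(1) \<beta>(2) by metis
  then show ?thesis
    using almost_exact_conjuncts[THEN conjunct2, THEN conjunct2, THEN conjunct2, THEN conjunct1]
      \<alpha> f \<beta> by blast
qed

text \<open>The same argument for (N3), with the identity now on the n-th object.\<close>

lemma pushout_in_E:
  assumes \<alpha>: "\<alpha> \<in> E" and g: "g \<in> Hom T (Dom T (hd \<alpha>)) C" "C \<in> A"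
    and \<beta>: "\<beta> \<in> Angles T" "last \<beta> = SusA T g \<cdot> last \<alpha>" "Dom T (hd \<beta>) = C"
  shows "\<beta> \<in> E"
proof -
  note d = mem_E_facts[OF \<alpha>]
  have l: "last \<beta> \<in> Hom T (Dom T (last \<alpha>)) (SusO T C)"
    using Comp_closed[OF d(4) SusA_Hom[OF g(1)]] \<beta>(2) by simp
  then have "Dom T (last \<beta>) = Dom T (last \<alpha>)" "last \<beta> \<cdot> Id T (Dom T (last \<alpha>)) = last \<beta>"
    using Comp_Id[OF l] by (auto simp: Hom_def)
  then obtain \<phi> where "is_seq_mor T n \<alpha> \<beta> \<phi>" "hd \<phi> = g" "last \<phi> = Id T (Dom T (last \<alpha>))"
    using ex_seq_mor_last[OF d(1) \<beta>(1), of g "Id T (Dom T (last \<alpha>))"] g(1) \<beta> Id_closed A_Obj d(3)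
    by metis
  then show ?thesis
    using almost_exact_conjuncts[THEN conjunct2, THEN conjunct2, THEN conjunct2, THEN conjunct2]
      \<alpha> g \<beta> by blast
qed

text \<open>Turns statements about phantoms back into statements about n-angles: sharing the last
  map with some member is enough, whatever the other maps are.\<close>

lemma mem_E_of_last_phantom:
  assumes "\<beta> \<in> Angles T" "last \<beta> \<in> phantoms E"
  shows "\<beta> \<in> E"
proof -
  note s = is_seq_hd_last[OF Angles_seq[OF assms(1)]]
  obtain \<alpha> where \<alpha>: "\<alpha> \<in> E" "last \<alpha> = last \<beta>" "Dom T (hd \<alpha>) = Dom T (hd \<beta>)"
    using phantom_angleE[OF assms(2) s(4,3)] by metis
  note d = mem_E_facts[OF \<alpha>(1)]
  have "Id T (Dom T (last \<alpha>)) \<in> Hom T (Dom T (last \<alpha>)) (Dom T (last \<alpha>))"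
    using Id_closed A_Obj d(3) by blast
  moreover have "last \<beta> = last \<alpha> \<cdot> Id T (Dom T (last \<alpha>))"
    unfolding Comp_Id[OF d(4)] using \<alpha>(2) by (rule sym)
  ultimately show ?thesis
    using pullback_in_E[OF \<alpha>(1) _ d(3) assms(1)] \<alpha>(3) by metis
qed

text \<open>\<open>ex_angle_last\<close> provides an n-angle with last map h f, and
  \<open>pullback_in_E\<close> places it in \<open>E\<close>.\<close>

lemma phantom_Comp:
  assumes "h \<in> phantoms E" "h \<in> Hom T X Z" "f \<in> Hom T B X" "B \<in> A"
  shows "h \<cdot> f \<in> phantoms E"
proof -
  obtain \<alpha> where \<alpha>: "\<alpha> \<in> E" "last \<alpha> = h"
    using assms(1) by (auto simp: phantoms_def)
  note d = mem_E_facts[OF \<alpha>(1)]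
  have f: "f \<in> Hom T B (Dom T (last \<alpha>))"
    using assms \<alpha> by (auto simp: Hom_def)
  obtain \<beta> where \<beta>: "\<beta> \<in> Angles T" "last \<beta> = last \<alpha> \<cdot> f" "Dom T (hd \<beta>) = Dom T (hd \<alpha>)"
    using ex_angle_last[OF Comp_closed[OF f d(4)]] A_Obj d(2) by blast
  show ?thesis
    using mem_E_facts(5)[OF pullback_in_E[OF \<alpha>(1) f assms(4) \<beta>]] \<beta>(2) \<alpha>(2) by simp
qed

lemma SusA_Comp_phantom:
  assumes "h \<in> phantoms E" "h \<in> Hom T X (SusO T Y)" "g \<in> Hom T Y C" "C \<in> A"
  shows "SusA T g \<cdot> h \<in> phantoms E"
proof -
  obtain \<alpha> where \<alpha>: "\<alpha> \<in> E" "last \<alpha> = h" "Dom T (hd \<alpha>) = Y"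
    using phantom_angleE[OF assms(1,2)] Hom_Obj[OF assms(3)] by metis
  note d = mem_E_facts[OF \<alpha>(1)]
  have g: "g \<in> Hom T (Dom T (hd \<alpha>)) C"
    using assms \<alpha> by simp
  obtain \<beta> where \<beta>: "\<beta> \<in> Angles T" "last \<beta> = SusA T g \<cdot> last \<alpha>" "Dom T (hd \<beta>) = C"
    using ex_angle_last[OF Comp_closed[OF d(4) SusA_Hom[OF g]]] A_Obj assms(4) by blast
  show ?thesis
    using mem_E_facts(5)[OF pushout_in_E[OF \<alpha>(1) g assms(4) \<beta>]] \<beta>(2) \<alpha>(2) by simp
qed

text \<open>Besides the zero phantoms, this supplies members of \<open>E\<close> with arbitrary
  prescribed ends in \<open>A\<close>.\<close>

lemma ex_split:
  assumes "X \<in> A" "Y \<in> A"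
  obtains \<alpha> where "\<alpha> \<in> E" "last \<alpha> = Zero T X (SusO T Y)" "Dom T (hd \<alpha>) = Y" "Dom T (last \<alpha>) = X"
proof -
  have z: "Zero T X (SusO T Y) \<in> Hom T X (SusO T Y)"
    using Zero_closed SusO_closed A_Obj assms by blast
  obtain \<alpha> where \<alpha>: "\<alpha> \<in> Angles T" "last \<alpha> = Zero T X (SusO T Y)" "Dom T (hd \<alpha>) = Y"
    using ex_angle_last[OF z] A_Obj assms by blast
  moreover have "\<alpha> \<in> E"
    using \<alpha> z assms by (intro E_split mem_angles_in) (auto simp: is_split_def Hom_def)
  ultimately show ?thesis
    using that z by (auto simp: Hom_def)
qed

lemma Zero_phantom: "X \<in> A \<Longrightarrow> Y \<in> A \<Longrightarrow> Zero T X (SusO T Y) \<in> phantoms E"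
  using ex_split mem_E_facts(5) by metis

text \<open>Closure of \<open>A\<close> under biproducts comes from (N1): the direct sum of split
  n-angles starting at X and at Y is again in \<open>E\<close>, so its first object, a biproduct of
  X and Y, lies in \<open>A\<close>.\<close>

lemma ex_biproduct_in:
  assumes "X \<in> A" "Y \<in> A"
  obtains P \<iota>1 \<iota>2 \<pi>1 \<pi>2 where "P \<in> A" "is_biproduct T X Y P \<iota>1 \<iota>2 \<pi>1 \<pi>2"
proof -
  obtain \<alpha> where \<alpha>: "\<alpha> \<in> E" "Dom T (hd \<alpha>) = X"
    using ex_split assms by metis
  obtain \<beta> where \<beta>: "\<beta> \<in> E" "Dom T (hd \<beta>) = Y"
    using ex_split assms by metis
  obtain \<gamma> where \<gamma>: "is_direct_sum T n \<alpha> \<beta> \<gamma>"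
    using ex_direct_sum Angles_seq mem_E_facts(1) \<alpha> \<beta> by metis
  show ?thesis
    using direct_sum_last[OF \<gamma>] mem_E_facts(2)[OF E_direct_sum[OF \<alpha>(1) \<beta>(1) \<gamma>]] \<alpha> \<beta> that by metis
qed

text \<open>The sum \<open>h + h'\<close> is \<open>\<Sigma>\<nabla> (h \<oplus> h') \<Delta>\<close>.\<close>

lemma Add_phantom:
  assumes h: "h \<in> phantoms E" "h \<in> Hom T X (SusO T Y)" and h': "h' \<in> phantoms E" "h' \<in> Hom T X (SusO T Y)"
    and Y: "Y \<in> Obj T"
  shows "h \<boxplus> h' \<in> phantoms E"
proof -
  obtain \<alpha> where \<alpha>: "\<alpha> \<in> E" "last \<alpha> = h" "Dom T (hd \<alpha>) = Y" "Dom T (last \<alpha>) = X" and XY: "X \<in> A" "Y \<in> A"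
    using phantom_angleE[OF h Y] by metis
  obtain \<beta> where \<beta>: "\<beta> \<in> E" "last \<beta> = h'" "Dom T (hd \<beta>) = Y" "Dom T (last \<beta>) = X"
    using phantom_angleE[OF h' Y] by metis
  obtain \<gamma> where \<gamma>: "is_direct_sum T n \<alpha> \<beta> \<gamma>"
    using ex_direct_sum Angles_seq mem_E_facts(1) \<alpha> \<beta> by metis
  note d = mem_E_facts[OF E_direct_sum[OF \<alpha>(1) \<beta>(1) \<gamma>]]
  define P where "P = Dom T (last \<gamma>)"
  define Q where "Q = Dom T (hd \<gamma>)"
  obtain \<iota>1 \<iota>2 \<pi>1 \<pi>2 \<kappa>1 \<kappa>2 \<rho>1 \<rho>2 where
    b: "is_biproduct T X X P \<iota>1 \<iota>2 \<pi>1 \<pi>2" "is_biproduct T Y Y Q \<kappa>1 \<kappa>2 \<rho>1 \<rho>2"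
    and eq: "last \<gamma> = (SusA T \<kappa>1 \<cdot> h \<cdot> \<pi>1) \<boxplus> (SusA T \<kappa>2 \<cdot> h' \<cdot> \<pi>2)"
    using direct_sum_last[OF \<gamma>] \<alpha> \<beta> unfolding P_def Q_def by metis
  have \<iota>: "\<iota>1 \<in> Hom T X P" "\<iota>2 \<in> Hom T X P" and \<pi>: "\<pi>1 \<in> Hom T P X" "\<pi>2 \<in> Hom T P X"
    and \<kappa>: "\<kappa>1 \<in> Hom T Y Q" "\<kappa>2 \<in> Hom T Y Q" and \<rho>: "\<rho>1 \<in> Hom T Q Y" "\<rho>2 \<in> Hom T Q Y"
    using b by (auto simp: is_biproduct_def)
  have Id: "Id T X \<in> Hom T X X" "Id T (SusO T Y) \<in> Hom T (SusO T Y) (SusO T Y)"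
    using XY A_Obj Id_closed SusO_closed by blast+
  have kh: "SusA T \<kappa>1 \<cdot> h \<in> Hom T X (SusO T Q)" "SusA T \<kappa>2 \<cdot> h' \<in> Hom T X (SusO T Q)"
    using h(2) h'(2) SusA_Hom[OF \<kappa>(1)] SusA_Hom[OF \<kappa>(2)] Comp_closed by blast+
  have \<Delta>: "\<iota>1 \<boxplus> \<iota>2 \<in> Hom T X P" and \<nabla>: "\<rho>1 \<boxplus> \<rho>2 \<in> Hom T Q Y"
    using \<iota> \<rho> Add_closed by blast+
  have "last \<gamma> = ((SusA T \<kappa>1 \<cdot> h) \<cdot> \<pi>1) \<boxplus> ((SusA T \<kappa>2 \<cdot> h') \<cdot> \<pi>2)"
    using eq Comp_assoc[OF \<pi>(1) h(2) SusA_Hom[OF \<kappa>(1)]] Comp_assoc[OF \<pi>(2) h'(2) SusA_Hom[OF \<kappa>(2)]]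
    by simp
  then have 1: "last \<gamma> \<cdot> (\<iota>1 \<boxplus> \<iota>2) = (SusA T \<kappa>1 \<cdot> h) \<boxplus> (SusA T \<kappa>2 \<cdot> h')"
    using biproduct_Comp[OF b(1) Id(1) Id(1) kh] Comp_Id \<iota> kh by simp
  have 2: "SusA T (\<rho>1 \<boxplus> \<rho>2) \<cdot> ((SusA T \<kappa>1 \<cdot> h) \<boxplus> (SusA T \<kappa>2 \<cdot> h')) = h \<boxplus> h'"
    using biproduct_Comp[OF SusA_biproduct[OF b(2)] h(2) h'(2) Id(2) Id(2)]
      Id_Comp[OF SusA_Hom[OF \<rho>(1)]] Id_Comp[OF SusA_Hom[OF \<rho>(2)]] Id_Comp[OF h(2)] Id_Comp[OF h'(2)]
      SusA_Add[OF \<rho>] by simp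
  have g: "last \<gamma> \<in> Hom T P (SusO T Q)"
    using d(4) by (simp add: P_def Q_def)
  show ?thesis
    using SusA_Comp_phantom[OF phantom_Comp[OF d(5) g \<Delta> XY(1)] Comp_closed[OF \<Delta> g] \<nabla> XY(2)] 1 2
    by simp
qed

text \<open>Since -h = h (-1), negatives come from closure under precomposition.\<close>

lemma Neg_phantom:
  assumes "h \<in> phantoms E" "h \<in> Hom T X Z" "X \<in> A"
  shows "Neg T h \<in> phantoms E"
proof -
  have Id: "Id T X \<in> Hom T X X"
    using A_Obj Id_closed assms(3) by blast
  show ?thesis
    using phantom_Comp[OF assms(1,2) Neg_closed[OF Id] assms(3)] Comp_Neg[OF Id assms(2)]
      Comp_Id[OF assms(2)] by simp
qed

section \<open>Structures cut out by classes of phantoms: \<open>PB\<close> and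
  \<open>PO\<close>\<close>

text \<open>Membership in \<open>E\<close> is inherited, so each axiom has to be checked on last
  maps alone, where it becomes a closure property of \<open>G\<close>. \<open>PB\<close> and
  \<open>PO\<close> are the instances with \<open>G\<close> a set of products.\<close>

lemma angles_with_phantoms_in_Ex_str:
  assumes sub: "G \<subseteq> phantoms E"
    and Zero: "\<And>X Y. X \<in> A \<Longrightarrow> Y \<in> A \<Longrightarrow> Zero T X (SusO T Y) \<in> G"
    and Add: "\<And>X Y h h'. h \<in> G \<Longrightarrow> h' \<in> G \<Longrightarrow> h \<in> Hom T X (SusO T Y) \<Longrightarrow>
      h' \<in> Hom T X (SusO T Y) \<Longrightarrow> X \<in> A \<Longrightarrow> Y \<in> A \<Longrightarrow> h \<boxplus> h' \<in> G"
    and pre: "\<And>B X Y f h. h \<in> G \<Longrightarrow> h \<in> Hom T X (SusO T Y) \<Longrightarrow> f \<in> Hom T B X \<Longrightarrow>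
      B \<in> A \<Longrightarrow> X \<in> A \<Longrightarrow> Y \<in> A \<Longrightarrow> h \<cdot> f \<in> G"
    and post: "\<And>X Y C g h. h \<in> G \<Longrightarrow> h \<in> Hom T X (SusO T Y) \<Longrightarrow> g \<in> Hom T Y C \<Longrightarrow>
      X \<in> A \<Longrightarrow> Y \<in> A \<Longrightarrow> C \<in> A \<Longrightarrow> SusA T g \<cdot> h \<in> G"
  shows "{\<alpha> \<in> E. last \<alpha> \<in> G} \<in> Ex_str T n A E"
proof -
  let ?F = "{\<alpha> \<in> E. last \<alpha> \<in> G}"
  have "almost_n_exact T n A ?F"
    unfolding almost_n_exact_def
  proof (intro conjI ballI allI impI; (elim conjE exE)?)
    show "?F \<subseteq> angles_in T n A"
      using E_subset by blast
  next
    fix \<alpha> \<beta> \<gamma> assume \<alpha>: "\<alpha> \<in> ?F" and \<beta>: "\<beta> \<in> ?F" and \<gamma>: "is_direct_sum T n \<alpha> \<beta> \<gamma>"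
    then have E: "\<alpha> \<in> E" "\<beta> \<in> E" "\<gamma> \<in> E" using E_direct_sum by blast+
    note a = mem_E_facts[OF E(1)] and b = mem_E_facts[OF E(2)] and c = mem_E_facts[OF E(3)]
    obtain \<iota>1 \<iota>2 \<pi>1 \<pi>2 \<kappa>1 \<kappa>2 \<rho>1 \<rho>2 where
      "is_biproduct T (Dom T (last \<alpha>)) (Dom T (last \<beta>)) (Dom T (last \<gamma>)) \<iota>1 \<iota>2 \<pi>1 \<pi>2"
      "is_biproduct T (Dom T (hd \<alpha>)) (Dom T (hd \<beta>)) (Dom T (hd \<gamma>)) \<kappa>1 \<kappa>2 \<rho>1 \<rho>2"
      and eq: "last \<gamma> = (SusA T \<kappa>1 \<cdot> last \<alpha> \<cdot> \<pi>1) \<boxplus> (SusA T \<kappa>2 \<cdot> last \<beta> \<cdot> \<pi>2)"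
      using direct_sum_last[OF \<gamma>] by metis
    then have m: "\<pi>1 \<in> Hom T (Dom T (last \<gamma>)) (Dom T (last \<alpha>))"
      "\<pi>2 \<in> Hom T (Dom T (last \<gamma>)) (Dom T (last \<beta>))"
      "\<kappa>1 \<in> Hom T (Dom T (hd \<alpha>)) (Dom T (hd \<gamma>))" "\<kappa>2 \<in> Hom T (Dom T (hd \<beta>)) (Dom T (hd \<gamma>))"
      by (auto simp: is_biproduct_def)
    note ap = Comp_closed[OF m(1) a(4)] and bp = Comp_closed[OF m(2) b(4)]
    \<comment> \<open>The last map of a direct sum is a sum of two terms, each a last map between a
      projection and a suspended injection, so the closures under both compositions and under sums
      act in turn.\<close>
    have "last \<alpha> \<cdot> \<pi>1 \<in> G" "last \<beta> \<cdot> \<pi>2 \<in> G"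
      using pre[OF _ a(4) m(1)] pre[OF _ b(4) m(2)] \<alpha> \<beta> a b c by blast+
    then have "SusA T \<kappa>1 \<cdot> last \<alpha> \<cdot> \<pi>1 \<in> G" "SusA T \<kappa>2 \<cdot> last \<beta> \<cdot> \<pi>2 \<in> G"
      using post[OF _ ap m(3)] post[OF _ bp m(4)] a b c by blast+
    then have "last \<gamma> \<in> G"
      using Add[OF _ _ Comp_closed[OF ap SusA_Hom[OF m(3)]] Comp_closed[OF bp SusA_Hom[OF m(4)]]] c eq
      by simp
    then show "\<gamma> \<in> ?F" using E by blast
  next
    fix \<alpha> assume "\<alpha> \<in> angles_in T n A" and s: "is_split T \<alpha>"
    then have \<alpha>: "\<alpha> \<in> E" using E_split by blast
    note a = mem_E_facts[OF \<alpha>]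
    have "last \<alpha> \<in> G"
      using s Zero[OF a(3,2)] HomD[OF a(4)] unfolding is_split_def by metis
    then show "\<alpha> \<in> ?F"
      using \<alpha> by blast
  next
    fix \<alpha> B f \<beta>
    assume \<alpha>: "\<alpha> \<in> ?F" and f: "B \<in> A" "f \<in> Hom T B (Dom T (last \<alpha>))"
      and \<beta>: "\<beta> \<in> Angles T" "Dom T (hd \<beta>) = Dom T (hd \<alpha>)" "last \<beta> = last \<alpha> \<cdot> f"
    then have E: "\<alpha> \<in> E" "last \<alpha> \<in> G" by auto
    note a = mem_E_facts[OF E(1)]
    show "\<beta> \<in> ?F"
      using pullback_in_E[OF E(1) f(2,1) \<beta>(1,3,2)] pre[OF E(2) a(4) f(2,1) a(3,2)] \<beta> by simp
  next
    fix \<alpha> C g \<beta>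
    assume \<alpha>: "\<alpha> \<in> ?F" and g: "C \<in> A" "g \<in> Hom T (Dom T (hd \<alpha>)) C"
      and \<beta>: "\<beta> \<in> Angles T" "Dom T (hd \<beta>) = C" "last \<beta> = SusA T g \<cdot> last \<alpha>"
    then have E: "\<alpha> \<in> E" "last \<alpha> \<in> G" by auto
    note a = mem_E_facts[OF E(1)]
    show "\<beta> \<in> ?F"
      using pushout_in_E[OF E(1) g(2,1) \<beta>(1,3,2)] post[OF E(2) a(4) g(2) a(3,2) g(1)] \<beta> by simp
  qed
  then show ?thesis
    by (auto simp: Ex_str_def)
qed

text \<open>Each side of \<psi> i has a factor that absorbs compositions: the ideal absorbs f on the
  right, the phantoms absorb \<Sigma> g on the left.\<close>

lemma PB_in_Ex_str:
  assumes I: "is_ideal T A I"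
  shows "PB T E I \<in> Ex_str T n A E"
proof -
  note I_facts = is_ideal_facts[OF I]
  define G where "G = {\<psi> \<cdot> i |\<psi> i. \<psi> \<in> phantoms E \<and> i \<in> I \<and> Dom T \<psi> = Cod T i}"
  \<comment> \<open>Types of the factors of a product: the middle object Z is the codomain of i, and
    lies in \<open>A\<close> because i is an arrow of \<open>A\<close>.\<close>
  have G_E: "\<exists>\<psi> i Z. h = \<psi> \<cdot> i \<and> \<psi> \<in> phantoms E \<and> i \<in> I \<and> Z \<in> A \<and>
      \<psi> \<in> Hom T Z (SusO T Y) \<and> i \<in> Hom T X Z"
    if h: "h \<in> G" "h \<in> Hom T X (SusO T Y)" for h X Y
  proof -
    obtain \<psi> i where \<psi>: "h = \<psi> \<cdot> i" "\<psi> \<in> phantoms E" "i \<in> I" "Dom T \<psi> = Cod T i"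
      using h(1) by (auto simp: G_def)
    then have "i \<in> Arr T" "\<psi> \<in> Arr T" "Cod T i \<in> A"
      using I_facts(1) phantomE[OF \<psi>(2)] by (auto simp: sub_arrows_def Hom_def)
    then have 1: "i \<in> Hom T (Dom T i) (Cod T i)" "\<psi> \<in> Hom T (Cod T i) (Cod T \<psi>)"
      using \<psi>(4) by (auto simp: Hom_def)
    then have "Dom T i = X" "Cod T \<psi> = SusO T Y"
      using Comp_closed[OF 1] h(2) \<psi>(1) by (auto simp: Hom_def)
    then show ?thesis
      using 1 \<psi> \<open>Cod T i \<in> A\<close> by metis
  qed
  have G_I: "\<psi> \<cdot> i \<in> G" if "\<psi> \<in> phantoms E" "i \<in> I" "\<psi> \<in> Hom T Z W" "i \<in> Hom T X Z" for \<psi> i X Z W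
  proof -
    have "Dom T \<psi> = Cod T i"
      using HomD[OF that(3)] HomD[OF that(4)] by simp
    with that(1,2) show ?thesis
      unfolding G_def by blast
  qed
  have "{\<alpha> \<in> E. last \<alpha> \<in> G} \<in> Ex_str T n A E"
  proof (rule angles_with_phantoms_in_Ex_str)
    show "G \<subseteq> phantoms E"
    proof
      fix h assume "h \<in> G"
      then obtain \<psi> i where \<psi>: "h = \<psi> \<cdot> i" "\<psi> \<in> phantoms E" "i \<in> I" "Dom T \<psi> = Cod T i"
        by (auto simp: G_def)
      have "i \<in> Hom T (Dom T i) (Dom T \<psi>)" "\<psi> \<in> Hom T (Dom T \<psi>) (Cod T \<psi>)" "Dom T i \<in> A"
        using I_facts(1) \<psi> phantomE[OF \<psi>(2)] by (auto simp: sub_arrows_def Hom_def)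
      then show "h \<in> phantoms E"
        using phantom_Comp[OF \<psi>(2)] \<psi>(1) by metis
    qed
  next
    fix X Y assume XY: "X \<in> A" "Y \<in> A"
    then have z: "Zero T X X \<in> Hom T X X" "Zero T X (SusO T Y) \<in> Hom T X (SusO T Y)"
      using A_Obj SusO_closed Zero_closed by blast+
    show "Zero T X (SusO T Y) \<in> G"
      using G_I[OF Zero_phantom[OF XY] I_facts(2)[OF XY(1,1)] z(2,1)] Zero_Comp[OF z(1)] z(2) Hom_Obj
      by metis
  next
    fix B X Y f h
    assume h: "h \<in> G" "h \<in> Hom T X (SusO T Y)" and f: "f \<in> Hom T B X" "B \<in> A" and XY: "X \<in> A" "Y \<in> A"
    obtain \<psi> i Z where \<psi>: "h = \<psi> \<cdot> i" "\<psi> \<in> phantoms E" "i \<in> I" "\<psi> \<in> Hom T Z (SusO T Y)" "i \<in> Hom T X Z"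
      using G_E[OF h] by blast
    show "h \<cdot> f \<in> G"
      using G_I[OF \<psi>(2) I_facts(4)[OF \<psi>(3,5) f] \<psi>(4) Comp_closed[OF f(1) \<psi>(5)]]
        Comp_assoc[OF f(1) \<psi>(5,4)] \<psi>(1) by simp
  next
    fix X Y C g h
    assume h: "h \<in> G" "h \<in> Hom T X (SusO T Y)" and g: "g \<in> Hom T Y C" "C \<in> A" and XY: "X \<in> A" "Y \<in> A"
    obtain \<psi> i Z where \<psi>: "h = \<psi> \<cdot> i" "\<psi> \<in> phantoms E" "i \<in> I" "\<psi> \<in> Hom T Z (SusO T Y)" "i \<in> Hom T X Z"
      using G_E[OF h] by blast
    show "SusA T g \<cdot> h \<in> G"
      using G_I[OF SusA_Comp_phantom[OF \<psi>(2,4) g] \<psi>(3) Comp_closed[OF \<psi>(4) SusA_Hom[OF g(1)]] \<psi>(5)]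
        Comp_assoc[OF \<psi>(5,4) SusA_Hom[OF g(1)]] \<psi>(1) by simp
  next
    fix X Y h h'
    assume h: "h \<in> G" "h \<in> Hom T X (SusO T Y)" and h': "h' \<in> G" "h' \<in> Hom T X (SusO T Y)"
      and XY: "X \<in> A" "Y \<in> A"
    obtain \<psi> i Z where \<psi>: "h = \<psi> \<cdot> i" "\<psi> \<in> phantoms E" "i \<in> I" "\<psi> \<in> Hom T Z (SusO T Y)" "i \<in> Hom T X Z"
      and Z: "Z \<in> A"
      using G_E[OF h] by blast
    obtain \<psi>' i' Z' where \<psi>': "h' = \<psi>' \<cdot> i'" "\<psi>' \<in> phantoms E" "i' \<in> I" "\<psi>' \<in> Hom T Z' (SusO T Y)" "i' \<in> Hom T X Z'"
      and Z': "Z' \<in> A"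
      using G_E[OF h'] by blast
    \<comment> \<open>The sum of two products is one product through P: (\<psi> \<pi>1 + \<psi>'
      \<pi>2) (\<iota>1 i + \<iota>2 i') = \<psi> i + \<psi>' i'.\<close>
    obtain P \<iota>1 \<iota>2 \<pi>1 \<pi>2 where P: "P \<in> A" and b: "is_biproduct T Z Z' P \<iota>1 \<iota>2 \<pi>1 \<pi>2"
      using ex_biproduct_in[OF Z Z'] by blast
    have m: "\<iota>1 \<in> Hom T Z P" "\<iota>2 \<in> Hom T Z' P" "\<pi>1 \<in> Hom T P Z" "\<pi>2 \<in> Hom T P Z'"
      using b by (auto simp: is_biproduct_def)
    note pc = Comp_closed[OF m(3) \<psi>(4)] Comp_closed[OF m(4) \<psi>'(4)]
    note ic = Comp_closed[OF \<psi>(5) m(1)] Comp_closed[OF \<psi>'(5) m(2)]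
    have "(\<psi> \<cdot> \<pi>1) \<boxplus> (\<psi>' \<cdot> \<pi>2) \<in> phantoms E"
      using Add_phantom[OF phantom_Comp[OF \<psi>(2,4) m(3) P] pc(1) phantom_Comp[OF \<psi>'(2,4) m(4) P] pc(2)]
        A_Obj XY by blast
    moreover have "(\<iota>1 \<cdot> i) \<boxplus> (\<iota>2 \<cdot> i') \<in> I"
      using I_facts(3)[OF I_facts(5)[OF \<psi>(3,5) m(1) P] I_facts(5)[OF \<psi>'(3,5) m(2) P] ic] .
    ultimately show "h \<boxplus> h' \<in> G"
      using G_I[OF _ _ Add_closed[OF pc] Add_closed[OF ic]]
        biproduct_Comp[OF b \<psi>(5) \<psi>'(5) \<psi>(4) \<psi>'(4)] \<psi>(1) \<psi>'(1) by simp
  qed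
  moreover have "PB T E I = {\<alpha> \<in> E. last \<alpha> \<in> G}"
    by (auto simp: PB_def G_def)
  ultimately show ?thesis by simp
qed

text \<open>Here the phantoms absorb f on the right, and the ideal absorbs g on the left because
  \<Sigma> g \<Sigma> j = \<Sigma> (g j).\<close>

lemma PO_in_Ex_str:
  assumes I: "is_ideal T A I"
  shows "PO T E I \<in> Ex_str T n A E"
proof -
  note I_facts = is_ideal_facts[OF I]
  define G where "G = {SusA T j \<cdot> \<psi> |\<psi> j. \<psi> \<in> phantoms E \<and> j \<in> I \<and> Dom T (SusA T j) = Cod T \<psi>}"
  have G_E': "\<exists>\<psi> j X Y Z. h = SusA T j \<cdot> \<psi> \<and> \<psi> \<in> phantoms E \<and> j \<in> I \<and> Z \<in> A \<and> X \<in> A \<and> Y \<in> A \<and>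
      \<psi> \<in> Hom T X (SusO T Z) \<and> j \<in> Hom T Z Y"
    if hG: "h \<in> G" for h
  proof -
    obtain \<psi> j where \<psi>: "h = SusA T j \<cdot> \<psi>" "\<psi> \<in> phantoms E" "j \<in> I" "Dom T (SusA T j) = Cod T \<psi>"
      using hG by (auto simp: G_def)
    obtain X Z' where XZ: "X \<in> A" "Z' \<in> A" "\<psi> \<in> Hom T X (SusO T Z')"
      using phantomE[OF \<psi>(2)] by blast
    have j: "j \<in> Arr T" "Dom T j \<in> A" "Cod T j \<in> A"
      using I_facts(1) \<psi>(3) by (auto simp: sub_arrows_def)
    \<comment> \<open>Composability is stated after applying \<Sigma>; injectivity on objects turns
      it into a statement about the source of j itself.\<close>
    then have "SusO T (Dom T j) = SusO T Z'"
      using Dom_Cod_SusA \<psi>(4) XZ by (auto simp: Hom_def)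
    then have "Dom T j = Z'"
      using SusO_inj A_Obj XZ j by blast
    then show ?thesis
      using \<psi> XZ j HomI[OF j(1)] by metis
  qed
  have G_E: "\<exists>\<psi> j Z. h = SusA T j \<cdot> \<psi> \<and> \<psi> \<in> phantoms E \<and> j \<in> I \<and> Z \<in> A \<and>
      \<psi> \<in> Hom T X (SusO T Z) \<and> j \<in> Hom T Z Y"
    if h: "h \<in> G" "h \<in> Hom T X (SusO T Y)" "Y \<in> A" for h X Y
  proof -
    obtain \<psi> j X' Y' Z where \<psi>: "h = SusA T j \<cdot> \<psi>" "\<psi> \<in> phantoms E" "j \<in> I" "Z \<in> A" "Y' \<in> A"
      "\<psi> \<in> Hom T X' (SusO T Z)" "j \<in> Hom T Z Y'"
      using G_E'[OF h(1)] by blast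
    have "X' = X" "SusO T Y' = SusO T Y"
      using Comp_closed[OF \<psi>(6) SusA_Hom[OF \<psi>(7)]] h(2) \<psi>(1) by (auto simp: Hom_def)
    moreover from this have "Y' = Y"
      using SusO_inj A_Obj h(3) \<psi>(5) by blast
    ultimately show ?thesis
      using \<psi> by blast
  qed
  have G_I: "SusA T j \<cdot> \<psi> \<in> G" if "\<psi> \<in> phantoms E" "j \<in> I" "\<psi> \<in> Hom T X (SusO T Z)" "j \<in> Hom T Z Y"
    for \<psi> j X Y Z
  proof -
    have "Dom T (SusA T j) = Cod T \<psi>"
      using HomD[OF SusA_Hom[OF that(4)]] HomD[OF that(3)] by simp
    with that(1,2) show ?thesis
      unfolding G_def by blast
  qed
  have "{\<alpha> \<in> E. last \<alpha> \<in> G} \<in> Ex_str T n A E"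
  proof (rule angles_with_phantoms_in_Ex_str)
    show "G \<subseteq> phantoms E"
    proof
      fix h assume "h \<in> G"
      then show "h \<in> phantoms E"
        using G_E' SusA_Comp_phantom by metis
    qed
  next
    fix X Y assume XY: "X \<in> A" "Y \<in> A"
    then have z: "Zero T Y Y \<in> Hom T Y Y" "Zero T X (SusO T Y) \<in> Hom T X (SusO T Y)" and X: "X \<in> Obj T"
      using A_Obj SusO_closed Zero_closed by blast+
    show "Zero T X (SusO T Y) \<in> G"
      using G_I[OF Zero_phantom[OF XY] I_facts(2)[OF XY(2,2)] z(2,1)] Comp_Zero[OF X SusA_Hom[OF z(1)]]
      by simp
  next
    fix B X Y f h
    assume h: "h \<in> G" "h \<in> Hom T X (SusO T Y)" and f: "f \<in> Hom T B X" "B \<in> A" and XY: "X \<in> A" "Y \<in> A"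
    obtain \<psi> j Z where \<psi>: "h = SusA T j \<cdot> \<psi>" "\<psi> \<in> phantoms E" "j \<in> I" "\<psi> \<in> Hom T X (SusO T Z)" "j \<in> Hom T Z Y"
      using G_E[OF h XY(2)] by blast
    show "h \<cdot> f \<in> G"
      using G_I[OF phantom_Comp[OF \<psi>(2,4) f] \<psi>(3) Comp_closed[OF f(1) \<psi>(4)] \<psi>(5)]
        Comp_assoc[OF f(1) \<psi>(4) SusA_Hom[OF \<psi>(5)]] \<psi>(1) by simp
  next
    fix X Y C g h
    assume h: "h \<in> G" "h \<in> Hom T X (SusO T Y)" and g: "g \<in> Hom T Y C" and XY: "X \<in> A" "Y \<in> A" "C \<in> A"
    obtain \<psi> j Z where \<psi>: "h = SusA T j \<cdot> \<psi>" "\<psi> \<in> phantoms E" "j \<in> I" "\<psi> \<in> Hom T X (SusO T Z)" "j \<in> Hom T Z Y"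
      using G_E[OF h XY(2)] by blast
    show "SusA T g \<cdot> h \<in> G"
      using G_I[OF \<psi>(2) I_facts(5)[OF \<psi>(3,5) g XY(3)] \<psi>(4) Comp_closed[OF \<psi>(5) g]]
        Comp_assoc[OF \<psi>(4) SusA_Hom[OF \<psi>(5)] SusA_Hom[OF g]] SusA_Comp[OF \<psi>(5) g] \<psi>(1) by simp
  next
    fix X Y h h'
    assume h: "h \<in> G" "h \<in> Hom T X (SusO T Y)" and h': "h' \<in> G" "h' \<in> Hom T X (SusO T Y)"
      and XY: "X \<in> A" "Y \<in> A"
    obtain \<psi> j Z where \<psi>: "h = SusA T j \<cdot> \<psi>" "\<psi> \<in> phantoms E" "j \<in> I" "\<psi> \<in> Hom T X (SusO T Z)" "j \<in> Hom T Z Y"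
      and Z: "Z \<in> A"
      using G_E[OF h XY(2)] by blast
    obtain \<psi>' j' Z' where \<psi>': "h' = SusA T j' \<cdot> \<psi>'" "\<psi>' \<in> phantoms E" "j' \<in> I" "\<psi>' \<in> Hom T X (SusO T Z')" "j' \<in> Hom T Z' Y"
      and Z': "Z' \<in> A"
      using G_E[OF h' XY(2)] by blast
    \<comment> \<open>The sum is \<Sigma> (j \<pi>1 + j' \<pi>2) after (\<Sigma> \<iota>1) \<psi> +
      (\<Sigma> \<iota>2) \<psi>'; additivity of \<Sigma> keeps the left factor the suspension of a
      single element of the ideal.\<close>
    obtain P \<iota>1 \<iota>2 \<pi>1 \<pi>2 where P: "P \<in> A" and b: "is_biproduct T Z Z' P \<iota>1 \<iota>2 \<pi>1 \<pi>2"
      using ex_biproduct_in[OF Z Z'] by blast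
    have m: "\<iota>1 \<in> Hom T Z P" "\<iota>2 \<in> Hom T Z' P" "\<pi>1 \<in> Hom T P Z" "\<pi>2 \<in> Hom T P Z'"
      using b by (auto simp: is_biproduct_def)
    note pc = Comp_closed[OF \<psi>(4) SusA_Hom[OF m(1)]] Comp_closed[OF \<psi>'(4) SusA_Hom[OF m(2)]]
    note jc = Comp_closed[OF m(3) \<psi>(5)] Comp_closed[OF m(4) \<psi>'(5)]
    have "(SusA T \<iota>1 \<cdot> \<psi>) \<boxplus> (SusA T \<iota>2 \<cdot> \<psi>') \<in> phantoms E"
      using Add_phantom[OF SusA_Comp_phantom[OF \<psi>(2,4) m(1) P] pc(1)
          SusA_Comp_phantom[OF \<psi>'(2,4) m(2) P] pc(2)] A_Obj P by blast
    moreover have "(j \<cdot> \<pi>1) \<boxplus> (j' \<cdot> \<pi>2) \<in> I"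
      using I_facts(3)[OF I_facts(4)[OF \<psi>(3,5) m(3) P] I_facts(4)[OF \<psi>'(3,5) m(4) P] jc] .
    moreover have "SusA T ((j \<cdot> \<pi>1) \<boxplus> (j' \<cdot> \<pi>2)) =
      (SusA T j \<cdot> SusA T \<pi>1) \<boxplus> (SusA T j' \<cdot> SusA T \<pi>2)"
      using SusA_Add[OF jc] SusA_Comp[OF m(3) \<psi>(5)] SusA_Comp[OF m(4) \<psi>'(5)] by simp
    ultimately show "h \<boxplus> h' \<in> G"
      using G_I[OF _ _ Add_closed[OF pc] Add_closed[OF jc]]
        biproduct_Comp[OF SusA_biproduct[OF b] \<psi>(4) \<psi>'(4) SusA_Hom[OF \<psi>(5)] SusA_Hom[OF \<psi>'(5)]]
        \<psi>(1) \<psi>'(1) by simp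
  qed
  moreover have "PO T E I = {\<alpha> \<in> E. last \<alpha> \<in> G}"
    by (auto simp: PO_def G_def)
  ultimately show ?thesis by simp
qed

section \<open>The residuals as ideals\<close>

lemma Ex_str_almost_exact_structure:
  assumes "F \<in> Ex_str T n A E"
  shows "almost_exact_structure T n A F"
  using assms ext_closed
  by (intro almost_exact_structure.intro n_angulated_category_axioms almost_exact_structure_axioms.intro)
    (auto simp: Ex_str_def)

text \<open>Zeros, sums, negatives and precomposition are inherited from the phantoms of
  \<open>F\<close>, as in h (f + g) = h f + h g. Postcomposition with g uses \<open>E\<close>
  instead: h g is again a phantom of \<open>E\<close>, hence an admissible test map.\<close>

lemma Phi_lower_is_ideal:
  assumes F: "F \<in> Ex_str T n A E"
  shows "is_ideal T A (Phi_lower T A E F)"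
proof -
  interpret F: almost_exact_structure T n A F
    by (rule Ex_str_almost_exact_structure[OF F])
  have D: "h \<cdot> \<phi> \<in> phantoms F"
    if "\<phi> \<in> Phi_lower T A E F" "\<phi> \<in> Hom T X Y" "h \<in> phantoms E" "h \<in> Hom T Y (SusO T Z)" for \<phi> h X Y Z
    using that by (auto simp: Phi_lower_def Hom_def)
  have I: "\<phi> \<in> Phi_lower T A E F" if \<phi>: "\<phi> \<in> Hom T X Y" "X \<in> A" "Y \<in> A"
    and step: "\<And>h Z. h \<in> phantoms E \<Longrightarrow> h \<in> Hom T Y (SusO T Z) \<Longrightarrow> Z \<in> A \<Longrightarrow> h \<cdot> \<phi> \<in> phantoms F" for \<phi> X Y
  proof -
    have "h \<cdot> \<phi> \<in> phantoms F" if h: "h \<in> phantoms E" "Dom T h = Cod T \<phi>" for h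
    proof -
      obtain Z where "h \<in> Hom T (Dom T h) (SusO T Z)" "Z \<in> A"
        using phantomE[OF h(1)] by (metis HomD)
      then show ?thesis
        using step[of h Z] h \<phi>(1)
        by (simp add: Hom_def)
    qed
    then show ?thesis
      using \<phi> by (auto simp: Phi_lower_def sub_arrows_def Hom_def)
  qed
  show ?thesis
  proof (rule is_idealI)
    show "Phi_lower T A E F \<subseteq> sub_arrows T A" by (auto simp: Phi_lower_def)
    show "A \<subseteq> Obj T" using A_Obj by blast
  next
    fix X Y assume XY: "X \<in> A" "Y \<in> A"
    then show "Zero T X Y \<in> Phi_lower T A E F"
      using A_Obj Zero_closed Comp_Zero F.Zero_phantom by (intro I[of _ X Y]) auto
  next
    fix f g X Y
    assume f: "f \<in> Phi_lower T A E F" and g: "g \<in> Phi_lower T A E F"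
      and h: "f \<in> Hom T X Y" "g \<in> Hom T X Y" and XY: "X \<in> A" "Y \<in> A"
    show "f \<boxplus> g \<in> Phi_lower T A E F"
    proof (rule I[OF Add_closed[OF h] XY])
      fix k Z assume k: "k \<in> phantoms E" "k \<in> Hom T Y (SusO T Z)" "Z \<in> A"
      show "k \<cdot> (f \<boxplus> g) \<in> phantoms F"
        using F.Add_phantom[OF D[OF f h(1) k(1,2)] Comp_closed[OF h(1) k(2)]
            D[OF g h(2) k(1,2)] Comp_closed[OF h(2) k(2)]] Comp_Add[OF h k(2)] A_Obj k(3) by simp
    qed
  next
    fix f X Y
    assume f: "f \<in> Phi_lower T A E F" "f \<in> Hom T X Y" and XY: "X \<in> A" "Y \<in> A"
    show "Neg T f \<in> Phi_lower T A E F"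
    proof (rule I[OF Neg_closed[OF f(2)] XY])
      fix k Z assume k: "k \<in> phantoms E" "k \<in> Hom T Y (SusO T Z)" "Z \<in> A"
      show "k \<cdot> Neg T f \<in> phantoms F"
        using F.Neg_phantom[OF D[OF f k(1,2)] Comp_closed[OF f(2) k(2)] XY(1)] Comp_Neg[OF f(2) k(2)]
        by simp
    qed
  next
    fix i f B X Y
    assume i: "i \<in> Phi_lower T A E F" "i \<in> Hom T X Y" and f: "f \<in> Hom T B X"
      and BXY: "B \<in> A" "X \<in> A" "Y \<in> A"
    show "i \<cdot> f \<in> Phi_lower T A E F"
    proof (rule I[OF Comp_closed[OF f i(2)] BXY(1,3)])
      fix k Z assume k: "k \<in> phantoms E" "k \<in> Hom T Y (SusO T Z)" "Z \<in> A"
      show "k \<cdot> i \<cdot> f \<in> phantoms F"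
        using F.phantom_Comp[OF D[OF i k(1,2)] Comp_closed[OF i(2) k(2)] f BXY(1)]
          Comp_assoc[OF f i(2) k(2)] by simp
    qed
  next
    fix i g X Y Z
    assume i: "i \<in> Phi_lower T A E F" "i \<in> Hom T X Y" and g: "g \<in> Hom T Y Z"
      and XYZ: "X \<in> A" "Y \<in> A" "Z \<in> A"
    show "g \<cdot> i \<in> Phi_lower T A E F"
    proof (rule I[OF Comp_closed[OF i(2) g] XYZ(1,3)])
      fix k W assume k: "k \<in> phantoms E" "k \<in> Hom T Z (SusO T W)" "W \<in> A"
      show "k \<cdot> g \<cdot> i \<in> phantoms F"
        using D[OF i phantom_Comp[OF k(1,2) g XYZ(2)] Comp_closed[OF g k(2)]]
          Comp_assoc[OF i(2) g k(2)] by simp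
    qed
  qed
qed

text \<open>\<Sigma> is bijective on arrows, so testing \<psi> against
  \<open>desuspended_phantoms T E\<close> amounts to testing \<Sigma> \<psi> against
  \<open>phantoms E\<close>. Desuspended phantoms are thereby confined to this lemma.\<close>

lemma mem_Phi_upper_iff:
  assumes "\<psi> \<in> Hom T X Y" "X \<in> A" "Y \<in> A"
  shows "\<psi> \<in> Phi_upper T A E F \<longleftrightarrow>
    (\<forall>h \<in> phantoms E. Cod T h = SusO T X \<longrightarrow> SusA T \<psi> \<cdot> h \<in> phantoms F)"
proof
  assume \<psi>: "\<psi> \<in> Phi_upper T A E F"
  show "\<forall>h \<in> phantoms E. Cod T h = SusO T X \<longrightarrow> SusA T \<psi> \<cdot> h \<in> phantoms F"
  proof (intro ballI impI)
    fix h assume h: "h \<in> phantoms E" "Cod T h = SusO T X"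
    then have "h \<in> Arr T"
      using phantomE by (metis HomD)
    then obtain h' where h': "h' \<in> Arr T" "SusA T h' = h"
      using SusA_surj by blast
    then have "Cod T h' = X"
      using h(2) Dom_Cod_SusA[OF h'(1)] SusO_inj Cod_closed A_Obj assms(2) by metis
    then have hom: "h' \<in> Hom T (Dom T h') X"
      using HomI[OF h'(1)] by simp
    have "h' \<in> desuspended_phantoms T E"
      using h h' by (simp add: desuspended_phantoms_def)
    then have "\<psi> \<cdot> h' \<in> desuspended_phantoms T F"
      using \<psi> assms(1) hom by (auto simp: Phi_upper_def Hom_def)
    then show "SusA T \<psi> \<cdot> h \<in> phantoms F"
      using SusA_Comp[OF hom assms(1)] h'(2) by (simp add: desuspended_phantoms_def)
  qed
next
  assume *: "\<forall>h \<in> phantoms E. Cod T h = SusO T X \<longrightarrow> SusA T \<psi> \<cdot> h \<in> phantoms F"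
  have "\<psi> \<cdot> h \<in> desuspended_phantoms T F"
    if "h \<in> desuspended_phantoms T E" "Dom T \<psi> = Cod T h" for h
  proof -
    have h: "h \<in> Arr T" "SusA T h \<in> phantoms E" "h \<in> Hom T (Dom T h) X"
      using that assms(1) by (auto simp: desuspended_phantoms_def Hom_def)
    then have "SusA T \<psi> \<cdot> SusA T h \<in> phantoms F"
      using * HomD[OF SusA_Hom[OF h(3)]] by blast
    then show ?thesis
      using SusA_Comp[OF h(3) assms(1)] HomD[OF Comp_closed[OF h(3) assms(1)]]
      by (simp add: desuspended_phantoms_def)
  qed
  then show "\<psi> \<in> Phi_upper T A E F"
    using assms by (auto simp: Phi_upper_def sub_arrows_def Hom_def)
qed

text \<open>The two sides are exchanged: precomposition with f uses that (\<Sigma> f) k is again a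
  phantom of \<open>E\<close>, while postcomposition is inherited from the phantoms of
  \<open>F\<close>.\<close>

lemma Phi_upper_is_ideal:
  assumes F: "F \<in> Ex_str T n A E"
  shows "is_ideal T A (Phi_upper T A E F)"
proof -
  interpret F: almost_exact_structure T n A F
    by (rule Ex_str_almost_exact_structure[OF F])
  have A_sub: "Phi_upper T A E F \<subseteq> sub_arrows T A" by (auto simp: Phi_upper_def)
  have D: "SusA T \<psi> \<cdot> h \<in> phantoms F"
    if "\<psi> \<in> Phi_upper T A E F" "\<psi> \<in> Hom T X Y" "h \<in> phantoms E" "h \<in> Hom T W (SusO T X)" for \<psi> h X Y W
  proof -
    have "X \<in> A" "Y \<in> A" using that A_sub by (auto simp: sub_arrows_def Hom_def)
    then show ?thesis
      using mem_Phi_upper_iff[OF that(2)] that HomD by metis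
  qed
  have I: "\<psi> \<in> Phi_upper T A E F" if "\<psi> \<in> Hom T X Y" "X \<in> A" "Y \<in> A"
    "\<And>h W. h \<in> phantoms E \<Longrightarrow> h \<in> Hom T W (SusO T X) \<Longrightarrow> W \<in> A \<Longrightarrow> SusA T \<psi> \<cdot> h \<in> phantoms F" for \<psi> X Y
    unfolding mem_Phi_upper_iff[OF that(1-3)] using that(4) phantomE HomD by metis
  show ?thesis
  proof (rule is_idealI)
    show "Phi_upper T A E F \<subseteq> sub_arrows T A" by (fact A_sub)
    show "A \<subseteq> Obj T" using A_Obj by blast
  next
    fix X Y assume XY: "X \<in> A" "Y \<in> A"
    then show "Zero T X Y \<in> Phi_upper T A E F"
      using A_Obj Zero_closed SusA_Zero Zero_Comp SusO_closed F.Zero_phantom by (intro I[of _ X Y]) auto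
  next
    fix f g X Y
    assume f: "f \<in> Phi_upper T A E F" and g: "g \<in> Phi_upper T A E F"
      and h: "f \<in> Hom T X Y" "g \<in> Hom T X Y" and XY: "X \<in> A" "Y \<in> A"
    note S = SusA_Hom[OF h(1)] SusA_Hom[OF h(2)]
    show "f \<boxplus> g \<in> Phi_upper T A E F"
    proof (rule I[OF Add_closed[OF h] XY])
      fix k W assume k: "k \<in> phantoms E" "k \<in> Hom T W (SusO T X)" "W \<in> A"
      show "SusA T (f \<boxplus> g) \<cdot> k \<in> phantoms F"
        using F.Add_phantom[OF D[OF f h(1) k(1,2)] Comp_closed[OF k(2) S(1)]
            D[OF g h(2) k(1,2)] Comp_closed[OF k(2) S(2)]] Add_Comp[OF k(2) S] SusA_Add[OF h]
          A_Obj XY(2) by simp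
    qed
  next
    fix f X Y
    assume f: "f \<in> Phi_upper T A E F" "f \<in> Hom T X Y" and XY: "X \<in> A" "Y \<in> A"
    show "Neg T f \<in> Phi_upper T A E F"
    proof (rule I[OF Neg_closed[OF f(2)] XY])
      fix k W assume k: "k \<in> phantoms E" "k \<in> Hom T W (SusO T X)" "W \<in> A"
      show "SusA T (Neg T f) \<cdot> k \<in> phantoms F"
        using F.Neg_phantom[OF D[OF f k(1,2)] Comp_closed[OF k(2) SusA_Hom[OF f(2)]] k(3)]
          Neg_Comp[OF k(2) SusA_Hom[OF f(2)]] SusA_Neg[OF f(2)] by simp
    qed
  next
    fix i f B X Y
    assume i: "i \<in> Phi_upper T A E F" "i \<in> Hom T X Y" and f: "f \<in> Hom T B X"
      and BXY: "B \<in> A" "X \<in> A" "Y \<in> A"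
    show "i \<cdot> f \<in> Phi_upper T A E F"
    proof (rule I[OF Comp_closed[OF f i(2)] BXY(1,3)])
      fix k W assume k: "k \<in> phantoms E" "k \<in> Hom T W (SusO T B)" "W \<in> A"
      show "SusA T (i \<cdot> f) \<cdot> k \<in> phantoms F"
        using D[OF i SusA_Comp_phantom[OF k(1,2) f BXY(2)] Comp_closed[OF k(2) SusA_Hom[OF f]]]
          Comp_assoc[OF k(2) SusA_Hom[OF f] SusA_Hom[OF i(2)]] SusA_Comp[OF f i(2)] by simp
    qed
  next
    fix i g X Y Z
    assume i: "i \<in> Phi_upper T A E F" "i \<in> Hom T X Y" and g: "g \<in> Hom T Y Z"
      and XYZ: "X \<in> A" "Y \<in> A" "Z \<in> A"
    show "g \<cdot> i \<in> Phi_upper T A E F"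
    proof (rule I[OF Comp_closed[OF i(2) g] XYZ(1,3)])
      fix k W assume k: "k \<in> phantoms E" "k \<in> Hom T W (SusO T X)" "W \<in> A"
      show "SusA T (g \<cdot> i) \<cdot> k \<in> phantoms F"
        using F.SusA_Comp_phantom[OF D[OF i k(1,2)] Comp_closed[OF k(2) SusA_Hom[OF i(2)]] g XYZ(3)]
          Comp_assoc[OF k(2) SusA_Hom[OF i(2)] SusA_Hom[OF g]] SusA_Comp[OF i(2) g] by simp
    qed
  qed
qed

section \<open>Adjunction between products and residuals\<close>

text \<open>From left to right, every composite h i is the last map of some n-angle of
  \<open>E\<close>, which then lies in \<open>PB T E I\<close> and so in \<open>F\<close>. From
  right to left, an n-angle is at first known only to have its last map among the phantoms of
  \<open>F\<close>; \<open>mem_E_of_last_phantom\<close>, taken for \<open>F\<close>, puts the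
  n-angle itself into \<open>F\<close>.\<close>

lemma PB_subset_iff:
  assumes I: "is_ideal T A I" and F: "F \<in> Ex_str T n A E"
  shows "PB T E I \<subseteq> F \<longleftrightarrow> I \<subseteq> Phi_lower T A E F"
proof
  interpret F: almost_exact_structure T n A F
    by (rule Ex_str_almost_exact_structure[OF F])
  have I_sub: "I \<subseteq> sub_arrows T A" using is_ideal_facts(1)[OF I] .
  {
    assume PB: "PB T E I \<subseteq> F"
    show "I \<subseteq> Phi_lower T A E F"
    proof
      fix i assume i: "i \<in> I"
      have "h \<cdot> i \<in> phantoms F" if h: "h \<in> phantoms E" "Dom T h = Cod T i" for h
      proof -
        have i': "i \<in> Hom T (Dom T i) (Dom T h)" "Dom T i \<in> A"
          using i I_sub h(2) by (auto simp: sub_arrows_def Hom_def)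
        have "h \<in> Hom T (Dom T h) (Cod T h)"
          using phantomE[OF h(1)] HomD HomI by metis
        then have "h \<cdot> i \<in> phantoms E"
          using phantom_Comp[OF h(1) _ i'] by blast
        then obtain \<alpha> where \<alpha>: "\<alpha> \<in> E" "last \<alpha> = h \<cdot> i"
          by (auto simp: phantoms_def)
        then have "\<alpha> \<in> PB T E I"
          using i h unfolding PB_def by force
        then have "\<alpha> \<in> F"
          using PB by blast
        then show ?thesis
          using F.mem_E_facts(5) \<alpha>(2) by metis
      qed
      then show "i \<in> Phi_lower T A E F"
        using i I_sub by (auto simp: Phi_lower_def)
    qed
  next
    assume sub: "I \<subseteq> Phi_lower T A E F"
    show "PB T E I \<subseteq> F"
    proof
      fix \<alpha> assume "\<alpha> \<in> PB T E I"
      then have "\<alpha> \<in> E" "last \<alpha> \<in> phantoms F"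
        using sub by (auto simp: PB_def Phi_lower_def)
      then show "\<alpha> \<in> F"
        using F.mem_E_of_last_phantom mem_E_facts(1) by blast
    qed
  }
qed

text \<open>The same argument, once \<open>mem_Phi_upper_iff\<close> has moved the test from
  desuspended phantoms to phantoms.\<close>

lemma PO_subset_iff:
  assumes I: "is_ideal T A I" and F: "F \<in> Ex_str T n A E"
  shows "PO T E I \<subseteq> F \<longleftrightarrow> I \<subseteq> Phi_upper T A E F"
proof
  interpret F: almost_exact_structure T n A F
    by (rule Ex_str_almost_exact_structure[OF F])
  have I_facts: "j \<in> Hom T (Dom T j) (Cod T j)" "Dom T j \<in> A" "Cod T j \<in> A"
    "Dom T (SusA T j) = SusO T (Dom T j)" if "j \<in> I" for j
    using is_ideal_facts(1)[OF I] that Dom_Cod_SusA by (auto simp: sub_arrows_def Hom_def)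
  {
    assume PO: "PO T E I \<subseteq> F"
    show "I \<subseteq> Phi_upper T A E F"
    proof
      fix j assume j: "j \<in> I"
      have "SusA T j \<cdot> h \<in> phantoms F" if h: "h \<in> phantoms E" "Cod T h = SusO T (Dom T j)" for h
      proof -
        have "h \<in> Hom T (Dom T h) (SusO T (Dom T j))"
          using phantomE[OF h(1)] HomD HomI h(2) by metis
        then have "SusA T j \<cdot> h \<in> phantoms E"
          using SusA_Comp_phantom[OF h(1) _ I_facts(1,3)[OF j]] by blast
        then obtain \<alpha> where \<alpha>: "\<alpha> \<in> E" "last \<alpha> = SusA T j \<cdot> h"
          by (auto simp: phantoms_def)
        then have "\<alpha> \<in> PO T E I"
          using j h I_facts(4)[OF j] unfolding PO_def by force
        then have "\<alpha> \<in> F"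
          using PO by blast
        then show ?thesis
          using F.mem_E_facts(5) \<alpha>(2) by metis
      qed
      then show "j \<in> Phi_upper T A E F"
        using mem_Phi_upper_iff[OF I_facts(1-3)[OF j]] by blast
    qed
  next
    assume sub: "I \<subseteq> Phi_upper T A E F"
    show "PO T E I \<subseteq> F"
    proof
      fix \<alpha> assume "\<alpha> \<in> PO T E I"
      then obtain j \<psi> where \<alpha>: "\<alpha> \<in> E" "j \<in> I" "\<psi> \<in> phantoms E" "Dom T (SusA T j) = Cod T \<psi>"
        "last \<alpha> = SusA T j \<cdot> \<psi>"
        by (auto simp: PO_def)
      then have "last \<alpha> \<in> phantoms F"
        using mem_Phi_upper_iff[OF I_facts(1-3)[OF \<alpha>(2)]] sub I_facts(4)[OF \<alpha>(2)] by auto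
      then show "\<alpha> \<in> F"
        using F.mem_E_of_last_phantom mem_E_facts(1) \<alpha>(1) by blast
    qed
  }
qed

end

section \<open>From the equivalences to Galois connections\<close>

lemma partial_order_inclusion_order: "partial_order (inclusion_order S)"
  by unfold_locales (auto simp: inclusion_order_def)

text \<open>\<open>galois_connection\<close> also requires both maps to be functions between the
  carriers, which is where the memberships in \<open>Ex_str\<close> and \<open>Ideals\<close> are
  consumed.\<close>

lemma galois_connection_inclusionI:
  assumes "\<And>x. x \<in> S \<Longrightarrow> l x \<in> S'" "\<And>y. y \<in> S' \<Longrightarrow> u y \<in> S"
    and "\<And>x y. x \<in> S \<Longrightarrow> y \<in> S' \<Longrightarrow> l x \<subseteq> y \<longleftrightarrow> x \<subseteq> u y"
  shows "galois_connection
    \<lparr>orderA = inclusion_order S, orderB = inclusion_order S', lower = l, upper = u\<rparr>"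
  using assms
  by (intro galois_connection.intro connection.intro galois_connection_axioms.intro)
    (auto simp: partial_order_inclusion_order, auto simp: inclusion_order_def)

theorem theorem4p7:
  fixes T :: "('o, 'm, 'e) angulated_data_scheme"
    and n :: nat
    and A :: "'o set"
    and E :: "'m list set"
  assumes "n_angulated_category T n"
    and "ext_closed_subcategory T n A"
    and "almost_n_exact T n A E"
  shows "galois_connection
      \<lparr>orderA = inclusion_order (Ideals T A), orderB = inclusion_order (Ex_str T n A E),
       lower = PB T E, upper = Phi_lower T A E\<rparr> \<and>
    galois_connection
      \<lparr>orderA = inclusion_order (Ideals T A), orderB = inclusion_order (Ex_str T n A E),
       lower = PO T E, upper = Phi_upper T A E\<rparr> \<and>
    (\<forall>I \<in> Ideals T A. \<forall>F \<in> Ex_str T n A E.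
      (PB T E I \<subseteq> F \<longleftrightarrow> I \<subseteq> Phi_lower T A E F) \<and>
      (PO T E I \<subseteq> F \<longleftrightarrow> I \<subseteq> Phi_upper T A E F))"
proof -
  interpret almost_exact_structure T n A E
    using assms by (intro almost_exact_structure.intro almost_exact_structure_axioms.intro)
  show ?thesis
    using PB_in_Ex_str PO_in_Ex_str Phi_lower_is_ideal Phi_upper_is_ideal PB_subset_iff PO_subset_iff
    by (intro conjI ballI galois_connection_inclusionI) (auto simp: Ideals_def)
qed

end
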